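(* Let $K\in\{\mathbb{R},\mathbb{C},\mathbb{H}\}$, let $d\ge 2$, let $q\in[1,2]$, and let $f:[0,1]\to\mathbb{R}$. Assume that there are real coefficients $a_0,a_1\ge 0$ and $a_k\le 0$ for $k\ge 2$ (finitely many of the $a_k$ nonzero, or infinitely many with the series converging for every $t\in[0,1]$) such that $$0\le f(t)\le h(t):=a_0+a_1t^2+\sum_{k\ge 2}a_kQ_{K,d}^{(k)}(t)\qquad\text{for all }t\in[0,1].$$ For $x,y\in K^d$ let $P(x,y)=|x|^q|y|^q f\left(\left|\left\langle \frac{x}{|x|},\frac{y}{|y|}\right\rangle\right|\right)$ if neither $x$ nor $y$ is $0$, and $P(x,y)=0$ otherwise. Then for any tight frame $\{y_1,\ldots,y_N\}$ in $K^d$ with frame constant $\frac Nd$, $$\sum_{i\ne j}P(y_i,y_j)\le N^2\left(\frac{a_1}{d}+a_0\right)-N\,h(1).$$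
   Context: $K^d$ carries the Hermitian product $\langle x,y\rangle=x^*y$ ($x^*$ is the conjugate transpose; for $K=\mathbb{H}$, $K^d$ is a right vector space) and norm $|x|=\sqrt{\langle x,x\rangle}$. A tight frame in $K^d$ with frame constant $A$ is a finite multiset of vectors $v_1,\ldots,v_N\in K^d$ with $\sum_{i=1}^N|\langle x,v_i\rangle|^2=A|x|^2$ for all $x\in K^d$ (equivalently $\sum_i v_iv_i^*=AI_d$). The vectors need not have unit norm. Sums over $i\neq j$ are over ordered pairs of distinct indices. $Q_{K,d}^{(k)}$ denotes the zonal spherical function of $K\mathbb{P}^{d-1}$ in the variable $t=|\langle x,y\rangle|$: $Q_{K,d}^{(k)}(t)=P_k^{(\alpha,\beta)}(2t^2-1)/P_k^{(\alpha,\beta)}(1)$, where $P_k^{(\alpha,\beta)}$ is the Jacobi polynomial of degree $k$ (orthogonal on $[-1,1]$ with weight $(1-x)^\alpha(1+x)^\beta$) with $\alpha=(d-1)\frac{\dim_{\mathbb{R}}K}{2}-1$ and $\beta=\frac{\dim_{\mathbb{R}}K}{2}-1$. *)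

theory Defs
  imports "HOL-Analysis.Analysis"
begin

section \<open>Quaternions\<close>

datatype quat = Quat (Re0: real) (Im1: real) (Im2: real) (Im3: real)

lemma quat_eq_iff:
  "x = y \<longleftrightarrow> Re0 x = Re0 y \<and> Im1 x = Im1 y \<and> Im2 x = Im2 y \<and> Im3 x = Im3 y"
  by (cases x; cases y) simp

instantiation quat :: "{zero, one, plus, minus, uminus, times, scaleR}"
begin

definition "0 = Quat 0 0 0 0"

definition "1 = Quat 1 0 0 0"

definition "x + y = Quat (Re0 x + Re0 y) (Im1 x + Im1 y) (Im2 x + Im2 y) (Im3 x + Im3 y)"

definition "x - y = Quat (Re0 x - Re0 y) (Im1 x - Im1 y) (Im2 x - Im2 y) (Im3 x - Im3 y)"

definition "- x = Quat (- Re0 x) (- Im1 x) (- Im2 x) (- Im3 x)"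

definition "x * y = Quat
  (Re0 x * Re0 y - Im1 x * Im1 y - Im2 x * Im2 y - Im3 x * Im3 y)
  (Re0 x * Im1 y + Im1 x * Re0 y + Im2 x * Im3 y - Im3 x * Im2 y)
  (Re0 x * Im2 y - Im1 x * Im3 y + Im2 x * Re0 y + Im3 x * Im1 y)
  (Re0 x * Im3 y + Im1 x * Im2 y - Im2 x * Im1 y + Im3 x * Re0 y)"

definition "r *\<^sub>R x = Quat (r * Re0 x) (r * Im1 x) (r * Im2 x) (r * Im3 x)"

instance ..

end

lemmas quat_ops = zero_quat_def one_quat_def plus_quat_def minus_quat_def uminus_quat_def
  times_quat_def scaleR_quat_def

lemma quat_sel [simp]:
  "Re0 0 = 0" "Im1 0 = 0" "Im2 0 = 0" "Im3 0 = 0"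
  "Re0 1 = 1" "Im1 1 = 0" "Im2 1 = 0" "Im3 1 = 0"
  "Re0 (x + y) = Re0 x + Re0 y" "Im1 (x + y) = Im1 x + Im1 y"
  "Im2 (x + y) = Im2 x + Im2 y" "Im3 (x + y) = Im3 x + Im3 y"
  "Re0 (x - y) = Re0 x - Re0 y" "Im1 (x - y) = Im1 x - Im1 y"
  "Im2 (x - y) = Im2 x - Im2 y" "Im3 (x - y) = Im3 x - Im3 y"
  "Re0 (- x) = - Re0 x" "Im1 (- x) = - Im1 x" "Im2 (- x) = - Im2 x" "Im3 (- x) = - Im3 x"
  "Re0 (r *\<^sub>R x) = r * Re0 x" "Im1 (r *\<^sub>R x) = r * Im1 x"
  "Im2 (r *\<^sub>R x) = r * Im2 x" "Im3 (r *\<^sub>R x) = r * Im3 x"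
  "Re0 (x * y) = Re0 x * Re0 y - Im1 x * Im1 y - Im2 x * Im2 y - Im3 x * Im3 y"
  "Im1 (x * y) = Re0 x * Im1 y + Im1 x * Re0 y + Im2 x * Im3 y - Im3 x * Im2 y"
  "Im2 (x * y) = Re0 x * Im2 y - Im1 x * Im3 y + Im2 x * Re0 y + Im3 x * Im1 y"
  "Im3 (x * y) = Re0 x * Im3 y + Im1 x * Im2 y - Im2 x * Im1 y + Im3 x * Re0 y"
  by (simp_all add: quat_ops)

instance quat :: real_algebra_1
  by standard (auto simp: quat_eq_iff algebra_simps)

instantiation quat :: real_inner
begin

definition "inner x y = Re0 x * Re0 y + Im1 x * Im1 y + Im2 x * Im2 y + Im3 x * Im3 y"

definition "norm (x :: quat) = sqrt (inner x x)"

definition "sgn (x :: quat) = x /\<^sub>R norm x"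

definition "dist x (y :: quat) = norm (x - y)"

definition [code del]:
  "(uniformity :: (quat \<times> quat) filter) = (INF e\<in>{0<..}. principal {(x, y). dist x y < e})"

definition [code del]:
  "open (U :: quat set) \<longleftrightarrow> (\<forall>x\<in>U. eventually (\<lambda>(x', y). x' = x \<longrightarrow> y \<in> U) uniformity)"

instance
proof
  fix x y z :: quat and r :: real and U :: "quat set"
  show "inner x x = 0 \<longleftrightarrow> x = 0"
    by (auto simp: inner_quat_def quat_eq_iff add_nonneg_eq_0_iff)
  show "norm x = sqrt (inner x x)"
    by (rule norm_quat_def)
  show "sgn x = x /\<^sub>R norm x"
    by (rule sgn_quat_def)
  show "dist x y = norm (x - y)"
    by (rule dist_quat_def)
  show "(uniformity :: (quat \<times> quat) filter) = (INF e\<in>{0<..}. principal {(x, y). dist x y < e})"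
    by (rule uniformity_quat_def)
  show "open U \<longleftrightarrow> (\<forall>x\<in>U. eventually (\<lambda>(x', y). x' = x \<longrightarrow> y \<in> U) uniformity)"
    by (rule open_quat_def)
qed (simp_all add: inner_quat_def algebra_simps)

end

instantiation quat :: real_normed_div_algebra
begin

definition "inverse x = Quat (Re0 x) (- Im1 x) (- Im2 x) (- Im3 x) /\<^sub>R (norm x)\<^sup>2"

definition "x div (y :: quat) = x * inverse y"

instance
proof
  fix x y :: quat
  have n: "(norm x)\<^sup>2 = (Re0 x)\<^sup>2 + (Im1 x)\<^sup>2 + (Im2 x)\<^sup>2 + (Im3 x)\<^sup>2" for x :: quat
    unfolding norm_quat_def by (simp add: inner_quat_def power2_eq_square)
  have "inner (x * y) (x * y) = inner x x * inner y y"
    unfolding inner_quat_def quat_sel by algebra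
  then show "norm (x * y) = norm x * norm y"
    by (simp add: norm_quat_def real_sqrt_mult)
  show "inverse x * x = 1" if "x \<noteq> 0"
  proof -
    have "Quat (Re0 x) (- Im1 x) (- Im2 x) (- Im3 x) * x = (norm x)\<^sup>2 *\<^sub>R 1"
      by (simp add: quat_eq_iff n) (simp add: power2_eq_square)
    then show ?thesis
      using that by (simp add: inverse_quat_def)
  qed
  show "x * inverse x = 1" if "x \<noteq> 0"
  proof -
    have "x * Quat (Re0 x) (- Im1 x) (- Im2 x) (- Im3 x) = (norm x)\<^sup>2 *\<^sub>R 1"
      by (simp add: quat_eq_iff n) (simp add: power2_eq_square)
    moreover have "x * inverse x =
        (x * Quat (Re0 x) (- Im1 x) (- Im2 x) (- Im3 x)) /\<^sub>R (norm x)\<^sup>2"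
      by (simp add: inverse_quat_def quat_eq_iff algebra_simps)
    ultimately show ?thesis
      using that by simp
  qed
  show "x div y = x * inverse y"
    by (rule divide_quat_def)
  show "inverse (0 :: quat) = 0"
    by (simp add: inverse_quat_def)
qed

end

instantiation quat :: euclidean_space
begin

definition "Basis = {Quat 1 0 0 0, Quat 0 1 0 0, Quat 0 0 1 0, Quat 0 0 0 1}"

instance
proof
  show "(Basis :: quat set) \<noteq> {}" "finite (Basis :: quat set)"
    by (simp_all add: Basis_quat_def)
  fix u v x :: quat
  show "inner u v = (if u = v then 1 else 0)" if "u \<in> Basis" "v \<in> Basis"
    using that unfolding Basis_quat_def by (elim insertE emptyE) (simp_all add: inner_quat_def)
  show "(\<forall>u\<in>Basis. inner x u = 0) \<longleftrightarrow> x = 0"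
    unfolding Basis_quat_def by (auto simp: inner_quat_def quat_eq_iff [of x])
qed

end

lemma DIM_quat [simp]: "DIM(quat) = 4"
  by (simp add: Basis_quat_def)

section \<open>Hermitian product\<close>

class conjugation =
  fixes conjg :: "'a \<Rightarrow> 'a"

instantiation real :: conjugation
begin
definition "conjg (x :: real) = x"
instance ..
end

instantiation complex :: conjugation
begin
definition "conjg = cnj"
instance ..
end

instantiation quat :: conjugation
begin
definition "conjg x = Quat (Re0 x) (- Im1 x) (- Im2 x) (- Im3 x)"
instance ..
end

definition hprod :: "'k::{conjugation, semiring_0} ^ 'n \<Rightarrow> 'k ^ 'n \<Rightarrow> 'k"
  where "hprod x y = (\<Sum>i\<in>UNIV. conjg (x $ i) * y $ i)"

text \<open>
  The library norm on \<open>'k ^ 'n\<close> is \<open>sqrt \<langle>x,x\<rangle>\<close> in all three cases.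
\<close>

lemma power2_norm_vec: "(norm (x :: 'k::real_normed_vector ^ 'n))\<^sup>2 = (\<Sum>i\<in>UNIV. (norm (x $ i))\<^sup>2)"
  by (simp add: norm_vec_def L2_set_def sum_nonneg)

lemma hprod_self:
  "hprod (x :: real ^ 'n) x = of_real ((norm x)\<^sup>2)"
  "hprod (u :: complex ^ 'n) u = of_real ((norm u)\<^sup>2)"
  "hprod (v :: quat ^ 'n) v = of_real ((norm v)\<^sup>2)"
proof -
  show "hprod x x = of_real ((norm x)\<^sup>2)"
    unfolding power2_norm_vec hprod_def conjg_real_def by (simp add: power2_eq_square)
  have "cnj a * a = of_real ((norm a)\<^sup>2)" for a
    by (simp add: complex_norm_square mult.commute del: of_real_power)
  then show "hprod u u = of_real ((norm u)\<^sup>2)"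
    by (simp add: power2_norm_vec hprod_def conjg_complex_def del: of_real_power)
  have "conjg a * a = of_real ((norm a)\<^sup>2)" for a :: quat
    by (simp add: of_real_def norm_quat_def inner_quat_def conjg_quat_def quat_eq_iff)
  then show "hprod v v = of_real ((norm v)\<^sup>2)"
    by (simp add: power2_norm_vec hprod_def del: of_real_power)
qed

text \<open>A multiset of \<open>N\<close> vectors is given by an enumeration \<open>y 0, \<dots>, y (N - 1)\<close>.\<close>

definition tight_frame ::
    "nat \<Rightarrow> (nat \<Rightarrow> 'k::{conjugation, real_normed_algebra} ^ 'n) \<Rightarrow> real \<Rightarrow> bool"
  where "tight_frame N y A \<longleftrightarrow>
    (\<forall>x. (\<Sum>i<N. (norm (hprod x (y i)))\<^sup>2) = A * (norm x)\<^sup>2)"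

section \<open>Zonal spherical functions\<close>

text \<open>
  Standard explicit form of the Jacobi polynomials; \<open>jacobi_orthogonal\<close> and
  \<open>jacobi_1\<close> below confirm that it is the usual orthogonal family
  with the usual value at \<open>1\<close>.
\<close>

definition jacobi :: "real \<Rightarrow> real \<Rightarrow> nat \<Rightarrow> real \<Rightarrow> real"
  where "jacobi \<alpha> \<beta> k x =
    (\<Sum>s\<le>k. ((real k + \<alpha>) gchoose (k - s)) * ((real k + \<beta>) gchoose s)
        * ((x - 1) / 2) ^ s * ((x + 1) / 2) ^ (k - s))"

lemma jacobi_1: "jacobi \<alpha> \<beta> k 1 = (real k + \<alpha>) gchoose k"
proof -
  have "jacobi \<alpha> \<beta> k 1 = (\<Sum>s\<le>k. if s = 0 then (real k + \<alpha>) gchoose k else 0)"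
    unfolding jacobi_def by (intro sum.cong) auto
  then show ?thesis by simp
qed

lemma alternating_pochhammer_sum:
  assumes "m < k"
  shows "(\<Sum>s\<le>k. (-1) ^ s * real (k choose s) * pochhammer (c + real (k - s)) m) = 0"
  using assms
proof (induction k arbitrary: m c)
  case 0
  then show ?case by simp
next
  case (Suc k)
  show ?case
  proof (cases m)
    case 0
    then show ?thesis
      using choose_alternating_sum [of "Suc k", where ?'a = real] by simp
  next
    case (Suc m')
    have diff: "pochhammer (z + 1) (Suc n) - pochhammer z (Suc n) = real (Suc n) * pochhammer (z + 1) n"
      for z :: real and n
      by (subst pochhammer_rec [of z], subst pochhammer_Suc) (simp add: algebra_simps)
    let ?g = "\<lambda>s. (-1) ^ s * real (k choose s)"
    let ?p = "\<lambda>j. pochhammer (c + real j) m"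
    have "(\<Sum>s\<le>Suc k. (-1) ^ s * real (Suc k choose s) * ?p (Suc k - s))
        = ?p (Suc k) + (\<Sum>s\<le>k. (-1) ^ Suc s * real (Suc k choose Suc s) * ?p (k - s))"
      by (subst sum.atMost_Suc_shift) simp
    also have "(\<Sum>s\<le>k. (-1) ^ Suc s * real (Suc k choose Suc s) * ?p (k - s))
        = (\<Sum>s\<le>k. (-1) ^ Suc s * real (k choose Suc s) * ?p (k - s)) - (\<Sum>s\<le>k. ?g s * ?p (k - s))"
    proof -
      have "(-1) ^ Suc s * real (Suc k choose Suc s) * ?p (k - s)
          = (-1) ^ Suc s * real (k choose Suc s) * ?p (k - s) - ?g s * ?p (k - s)" for s
        by (simp add: algebra_simps)
      then show ?thesis
        by (simp only: sum_subtractf)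
    qed
    also have "?p (Suc k) + ((\<Sum>s\<le>k. (-1) ^ Suc s * real (k choose Suc s) * ?p (k - s)) - (\<Sum>s\<le>k. ?g s * ?p (k - s)))
        = (\<Sum>s\<le>Suc k. ?g s * ?p (Suc k - s)) - (\<Sum>s\<le>k. ?g s * ?p (k - s))"
      by (subst sum.atMost_Suc_shift) simp
    also have "(\<Sum>s\<le>Suc k. ?g s * ?p (Suc k - s)) = (\<Sum>s\<le>k. ?g s * ?p (Suc k - s))"
      by simp
    also have "\<dots> - (\<Sum>s\<le>k. ?g s * ?p (k - s)) = (\<Sum>s\<le>k. ?g s * (?p (Suc k - s) - ?p (k - s)))"
      by (simp add: sum_subtractf right_diff_distrib)
    also have "\<dots> = (\<Sum>s\<le>k. real m * (?g s * pochhammer (c + 1 + real (k - s)) m'))"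
    proof (intro sum.cong refl)
      fix s assume "s \<in> {..k}"
      then have "c + real (Suc k - s) = (c + real (k - s)) + 1"
        by (simp add: of_nat_diff)
      then show "?g s * (?p (Suc k - s) - ?p (k - s)) = real m * (?g s * pochhammer (c + 1 + real (k - s)) m')"
        using diff [of "c + real (k - s)" m'] Suc by (simp add: algebra_simps)
    qed
    also have "\<dots> = real m * (\<Sum>s\<le>k. ?g s * pochhammer (c + 1 + real (k - s)) m')"
      by (simp add: sum_distrib_left)
    also have "\<dots> = 0"
      using Suc.IH [of m' "c + 1"] Suc Suc.prems by simp
    finally show ?thesis .
  qed
qed

lemma jacobi_coeff_Beta:
  assumes "\<alpha> > -1" "\<beta> > -1" "s \<le> k"
  shows "((real k + \<alpha>) gchoose (k - s)) * ((real k + \<beta>) gchoose s)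
      * Beta (\<beta> + real (k - s) + real m + 1) (\<alpha> + real s + 1)
    = Gamma (real k + \<alpha> + 1) * Gamma (real k + \<beta> + 1) / (fact k * Gamma (\<alpha> + \<beta> + real k + real m + 2))
      * (real (k choose s) * pochhammer (\<beta> + 1 + real (k - s)) m)"
proof -
  have ni: "x \<notin> \<int>\<^sub>\<le>\<^sub>0" if "x > 0" for x :: real
    using that nonpos_Ints_nonpos by force
  have pos: "Gamma x \<noteq> 0" if "x > 0" for x :: real
    using Gamma_real_pos [OF that] by simp
  have p1: "\<alpha> + real s + 1 > 0" and p2: "\<beta> + real (k - s) + 1 > 0"
    using assms by auto
  have c1: "((real k + \<alpha>) gchoose (k - s)) = Gamma (real k + \<alpha> + 1) / (fact (k - s) * Gamma (\<alpha> + real s + 1))"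
    using assms by (subst gbinomial_Gamma) (auto intro!: ni simp: of_nat_diff algebra_simps)
  have c2: "((real k + \<beta>) gchoose s) = Gamma (real k + \<beta> + 1) / (fact s * Gamma (\<beta> + real (k - s) + 1))"
    using assms by (subst gbinomial_Gamma) (auto intro!: ni simp: of_nat_diff algebra_simps)
  have p: "pochhammer (\<beta> + 1 + real (k - s)) m
      = Gamma (\<beta> + real (k - s) + real m + 1) / Gamma (\<beta> + real (k - s) + 1)"
    using p2 by (subst pochhammer_Gamma) (auto intro!: ni simp: algebra_simps)
  have b: "Beta (\<beta> + real (k - s) + real m + 1) (\<alpha> + real s + 1)
      = Gamma (\<beta> + real (k - s) + real m + 1) * Gamma (\<alpha> + real s + 1) / Gamma (\<alpha> + \<beta> + real k + real m + 2)"
    unfolding Beta_def using assms by (simp add: of_nat_diff algebra_simps)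
  have ch: "real (k choose s) = fact k / (fact s * fact (k - s))"
    using assms by (simp add: binomial_fact)
  show ?thesis
    unfolding c1 c2 p b ch using pos [OF p1] by simp
qed

lemma jacobi_orthogonal_power:
  assumes "\<alpha> > -1" "\<beta> > -1" "m < k"
  shows "((\<lambda>x. (1 - x) powr \<alpha> * (1 + x) powr \<beta> * jacobi \<alpha> \<beta> k x * (1 + x) ^ m)
    has_integral 0) {-1..1}"
proof -
  define G where "G = Gamma (real k + \<alpha> + 1) * Gamma (real k + \<beta> + 1)
    / (fact k * Gamma (\<alpha> + \<beta> + real k + real m + 2))"
  define C where "C = (\<lambda>s. ((real k + \<alpha>) gchoose (k - s)) * ((real k + \<beta>) gchoose s))"
  define F where "F = (\<lambda>t. 2 powr \<alpha> * 2 powr \<beta> * 2 ^ m * (\<Sum>s\<le>k. (-1) ^ s * C s *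
    (t powr (\<beta> + real (k - s) + real m + 1 - 1) * (1 - t) powr (\<alpha> + real s + 1 - 1))))"
  have "(F has_integral 2 powr \<alpha> * 2 powr \<beta> * 2 ^ m * (\<Sum>s\<le>k. (-1) ^ s * C s *
      Beta (\<beta> + real (k - s) + real m + 1) (\<alpha> + real s + 1))) {0..1}"
    unfolding F_def using assms
    by (intro has_integral_mult_right has_integral_sum has_integral_Beta_real) auto
  also have "(\<Sum>s\<le>k. (-1) ^ s * C s * Beta (\<beta> + real (k - s) + real m + 1) (\<alpha> + real s + 1))
      = (\<Sum>s\<le>k. G * ((-1) ^ s * real (k choose s) * pochhammer (\<beta> + 1 + real (k - s)) m))"
  proof (intro sum.cong refl)
    fix s assume "s \<in> {..k}"
    then have "C s * Beta (\<beta> + real (k - s) + real m + 1) (\<alpha> + real s + 1)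
        = G * (real (k choose s) * pochhammer (\<beta> + 1 + real (k - s)) m)"
      using jacobi_coeff_Beta [OF assms(1,2), of s k m] by (simp add: C_def G_def)
    then show "(-1) ^ s * C s * Beta (\<beta> + real (k - s) + real m + 1) (\<alpha> + real s + 1)
        = G * ((-1) ^ s * real (k choose s) * pochhammer (\<beta> + 1 + real (k - s)) m)"
      by (simp only: mult.assoc mult.left_commute [of G])
  qed
  also have "\<dots> = 0"
    using alternating_pochhammer_sum [OF assms(3), of "\<beta> + 1"]
    by (simp add: sum_distrib_left [symmetric])
  finally have F: "(F has_integral 0) (cbox 0 1)"
    by simp
  have "((\<lambda>x. F ((1/2) *\<^sub>R x + 1/2)) has_integral 0) {-1..1}"
    using has_integral_affinity [OF F, of "1/2" "1/2"] by (simp add: image_affinity_atLeastAtMost_diff)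
  moreover have "F ((1/2) *\<^sub>R x + 1/2)
      = (1 - x) powr \<alpha> * (1 + x) powr \<beta> * jacobi \<alpha> \<beta> k x * (1 + x) ^ m"
    if "x \<in> {-1..1}" for x
  proof -
    define t where "t = (1/2) *\<^sub>R x + 1/2"
    have x: "x = 2 * t - 1" by (simp add: t_def)
    have t: "0 \<le> t" "t \<le> 1" using that by (auto simp: x)
    have pw: "u powr (c + real n) = u powr c * u ^ n" if "u \<ge> 0" for u c :: real and n
      using that by (cases "u = 0") (auto simp: powr_add powr_realpow)
    have e: "(1 - x) powr \<alpha> = 2 powr \<alpha> * (1 - t) powr \<alpha>" "(1 + x) powr \<beta> = 2 powr \<beta> * t powr \<beta>"
      using t by (simp_all add: x powr_mult [symmetric] algebra_simps)
    have j: "jacobi \<alpha> \<beta> k x = (\<Sum>s\<le>k. (-1) ^ s * C s * ((1 - t) ^ s * t ^ (k - s)))"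
      unfolding jacobi_def
    proof (intro sum.cong refl)
      fix s
      have "(x - 1) / 2 = (-1) * (1 - t)" "(x + 1) / 2 = t"
        by (simp_all add: x)
      then have "((x - 1) / 2) ^ s = (-1) ^ s * (1 - t) ^ s" "((x + 1) / 2) ^ (k - s) = t ^ (k - s)"
        by (simp_all only: power_mult_distrib)
      then show "((real k + \<alpha>) gchoose (k - s)) * ((real k + \<beta>) gchoose s)
          * ((x - 1) / 2) ^ s * ((x + 1) / 2) ^ (k - s)
          = (-1) ^ s * C s * ((1 - t) ^ s * t ^ (k - s))"
        by (simp only: C_def ac_simps)
    qed
    have "F t = 2 powr \<alpha> * 2 powr \<beta> * 2 ^ m * (\<Sum>s\<le>k. (1 - t) powr \<alpha> * t powr \<beta> * t ^ m
        * ((-1) ^ s * C s * ((1 - t) ^ s * t ^ (k - s))))"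
    proof -
      have "(-1) ^ s * C s * (t powr (\<beta> + real (k - s) + real m + 1 - 1) * (1 - t) powr (\<alpha> + real s + 1 - 1))
          = (1 - t) powr \<alpha> * t powr \<beta> * t ^ m * ((-1) ^ s * C s * ((1 - t) ^ s * t ^ (k - s)))" for s
      proof -
        have "t powr (\<beta> + real (k - s) + real m + 1 - 1) = t powr \<beta> * t ^ (k - s) * t ^ m"
          using t pw [of t "\<beta> + real (k - s)" m] pw [of t \<beta> "k - s"] by simp
        moreover have "(1 - t) powr (\<alpha> + real s + 1 - 1) = (1 - t) powr \<alpha> * (1 - t) ^ s"
          using t pw [of "1 - t" \<alpha> s] by simp
        ultimately show ?thesis
          by (simp only: ac_simps)
      qed
      then show ?thesis
        unfolding F_def by (simp only:)
    qed
    also have "\<dots> = (1 - x) powr \<alpha> * (1 + x) powr \<beta> * jacobi \<alpha> \<beta> k x * (1 + x) ^ m"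
      unfolding e j by (simp add: x power_mult_distrib sum_distrib_left [symmetric])
    finally show ?thesis by (simp add: t_def)
  qed
  ultimately show ?thesis
    by (rule has_integral_cong [THEN iffD1, rotated])
qed

lemma jacobi_orthogonal:
  assumes "\<alpha> > -1" "\<beta> > -1" "degree p < k"
  shows "((\<lambda>x. (1 - x) powr \<alpha> * (1 + x) powr \<beta> * jacobi \<alpha> \<beta> k x * poly p x)
    has_integral 0) {-1..1}"
proof -
  define r where "r = pcompose p [:-1, 1:]"
  have deg: "degree r = degree p"
    by (simp add: r_def degree_pcompose)
  have p: "poly p x = (\<Sum>i\<le>degree p. coeff r i * (1 + x) ^ i)" for x
  proof -
    have "poly p x = poly r (1 + x)"
      by (simp add: r_def poly_pcompose)
    then show ?thesis
      by (simp add: poly_altdef deg)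
  qed
  have "((\<lambda>x. \<Sum>i\<le>degree p. coeff r i
      * ((1 - x) powr \<alpha> * (1 + x) powr \<beta> * jacobi \<alpha> \<beta> k x * (1 + x) ^ i))
    has_integral (\<Sum>i\<le>degree p. coeff r i * 0)) {-1..1}"
    using assms
    by (intro has_integral_sum has_integral_mult_right jacobi_orthogonal_power) auto
  then show ?thesis
    by (simp add: p sum_distrib_left mult_ac)
qed

text \<open>
  The zonal function of degree \<open>k\<close> on the projective space of \<open>K ^ d\<close>, in the variable
  \<open>t = |\<langle>x,y\<rangle>|\<close>. The scalars \<open>K\<close> are passed as a type, with real dimension \<open>DIM('k)\<close>.
\<close>

definition zonal :: "'k::euclidean_space itself \<Rightarrow> nat \<Rightarrow> nat \<Rightarrow> real \<Rightarrow> real"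
  where "zonal K d k t =
    (let \<alpha> = (real d - 1) * (real DIM('k) / 2) - 1;
         \<beta> = real DIM('k) / 2 - 1
     in jacobi \<alpha> \<beta> k (2 * t\<^sup>2 - 1) / jacobi \<alpha> \<beta> k 1)"

definition majorant :: "'k::euclidean_space itself \<Rightarrow> nat \<Rightarrow> (nat \<Rightarrow> real) \<Rightarrow> real \<Rightarrow> real"
  where "majorant K d a t = a 0 + a 1 * t\<^sup>2 + (\<Sum>k. a (k + 2) * zonal K d (k + 2) t)"

definition potential ::
    "real \<Rightarrow> (real \<Rightarrow> real) \<Rightarrow> 'k::{conjugation, real_normed_algebra} ^ 'n \<Rightarrow> 'k ^ 'n \<Rightarrow> real"
  where "potential q f x y =
    (if x = 0 \<or> y = 0 then 0
     else norm x powr q * norm y powr q * f (norm (hprod (x /\<^sub>R norm x) (y /\<^sub>R norm y))))"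

end

theory Submission
  imports Defs
begin

text \<open>
  Up to the factor \<open>|x|\<^sup>2\<^sup>k|z|\<^sup>2\<^sup>k\<close> the zonal function of degree \<open>k\<close> is a polynomial
  \<open>Z\<^sub>x(z)\<close>, homogeneous of degree \<open>2k\<close> and harmonic in \<open>z\<close>. In the Fischer inner product on
  forms, for which \<open>\<langle>(w\<bullet>z)\<^sup>n, p\<rangle> = p(w)\<close>, multiplication by \<open>|z|\<^sup>2\<close> is adjoint to a multiple of the
  Laplacian, and pairing with \<open>|\<langle>y,z\<rangle>|\<^sup>2\<^sup>k\<close> evaluates \<open>Z\<^sub>x\<close> at \<open>y\<close> up to a positive factor, because
  \<open>Z\<^sub>x\<close> is constant on unit scalar multiples of \<open>y\<close>. As \<open>Z\<^sub>y\<close> is a positive multiple of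
  \<open>|\<langle>y,z\<rangle>|\<^sup>2\<^sup>k\<close> modulo \<open>|z|\<^sup>2\<close>, the numbers \<open>Z\<^sub>x(y)\<close> form a Gram matrix up to a positive factor,
  so the terms of degree \<open>k \<ge> 2\<close> of \<open>h\<close> contribute at most \<open>0\<close>. The quadratic term is
  bounded by Schur's test, and the sums of powers of \<open>|y\<^sub>i|\<close> by Bernoulli's inequality and
  \<open>\<Sum>|y\<^sub>i|\<^sup>2 = N\<close>.
\<close>

section \<open>Sums of powers of linear forms\<close>

text \<open>A list of weighted points stands for the form
  \<open>z \<mapsto> comb r (\<lambda>w. (w \<bullet> z) ^ n)\<close>. For a form \<open>f\<close>
  of degree \<open>n\<close>, \<open>comb r f\<close> is its Fischer product with that form.\<close>

definition comb :: "(real \<times> 'a) list \<Rightarrow> ('a \<Rightarrow> real) \<Rightarrow> real"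
  where "comb r f = (\<Sum>(c, w)\<leftarrow>r. c * f w)"

lemma comb_Nil [simp]: "comb [] f = 0"
  by (simp add: comb_def)

lemma comb_Cons [simp]: "comb ((c, w) # r) f = c * f w + comb r f"
  by (simp add: comb_def)

lemma comb_append [simp]: "comb (r @ s) f = comb r f + comb s f"
  by (simp add: comb_def)

lemma comb_scale: "comb (map (\<lambda>(c, w). (d * c, w)) r) f = d * comb r f"
  by (induction r) (auto simp: algebra_simps)

lemma comb_add: "comb r (\<lambda>w. f w + g w) = comb r f + comb r g"
  by (induction r) (auto simp: algebra_simps)

lemma comb_cmult: "comb r (\<lambda>w. d * f w) = d * comb r f"
  by (induction r) (auto simp: algebra_simps)

lemma comb_diff: "comb r (\<lambda>w. f w - g w) = comb r f - comb r g"
  by (induction r) (auto simp: algebra_simps)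

lemma comb_zero [simp]: "comb r (\<lambda>w. 0) = 0"
  by (induction r) auto

lemma comb_sum: "comb r (\<lambda>w. \<Sum>i\<in>I. f i w) = (\<Sum>i\<in>I. comb r (f i))"
  by (induction r) (auto simp: sum.distrib sum_distrib_left)

text \<open>For \<open>g w v = (w \<bullet> v) ^ n\<close> this is the symmetry of the Fischer
  product: either factor may be expanded into powers.\<close>

lemma comb_swap: "comb r (\<lambda>w. comb s (\<lambda>v. g w v)) = comb s (\<lambda>v. comb r (\<lambda>w. g w v))"
  by (induction r) (auto simp: comb_add comb_cmult)

text \<open>The numbers \<open>(v \<bullet> w) ^ n\<close> are the Gram matrix of the n-th tensor
  powers of the points. This is positivity of the Fischer product.\<close>

lemma comb_inner_power_nonneg:
  fixes r :: "(real \<times> 'a::euclidean_space) list"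
  shows "comb r (\<lambda>w. comb r (\<lambda>v. (v \<bullet> w) ^ n)) \<ge> 0"
proof -
  \<comment> \<open>The weight \<open>f\<close> is arbitrary because each induction step expands one
    factor \<open>v \<bullet> w\<close> over the basis and moves the coordinates into the
    weight.\<close>
  have "comb r (\<lambda>w. f w * comb r (\<lambda>v. f v * (v \<bullet> w) ^ n)) \<ge> 0" for f
  proof (induction n arbitrary: f)
    case 0
    have "comb r (\<lambda>w. f w * comb r f) = comb r (\<lambda>w. comb r f * f w)"
      by (simp add: mult.commute)
    then show ?case by (simp add: comb_cmult)
  next
    case (Suc n)
    have "comb r (\<lambda>w. f w * comb r (\<lambda>v. f v * (v \<bullet> w) ^ Suc n))
      = (\<Sum>b\<in>Basis. comb r (\<lambda>w. (f w * (w \<bullet> b)) * comb r (\<lambda>v. (f v * (v \<bullet> b)) * (v \<bullet> w) ^ n)))"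
    proof -
      have "f w * comb r (\<lambda>v. f v * (v \<bullet> w) ^ Suc n)
        = (\<Sum>b\<in>Basis. (f w * (w \<bullet> b)) * comb r (\<lambda>v. (f v * (v \<bullet> b)) * (v \<bullet> w) ^ n))" for w
      proof -
        have "f v * (v \<bullet> w) ^ Suc n = (\<Sum>b\<in>Basis. (w \<bullet> b) * ((f v * (v \<bullet> b)) * (v \<bullet> w) ^ n))" for v
          by (subst power_Suc, subst euclidean_inner [of v w])
            (simp add: sum_distrib_left sum_distrib_right mult_ac)
        then show ?thesis
          by (simp add: comb_sum comb_cmult sum_distrib_left mult.assoc)
      qed
      then show ?thesis by (simp add: comb_sum)
    qed
    then show ?case using Suc by (simp add: sum_nonneg)
  qed
  from this [of "\<lambda>_. 1"] show ?thesis by simp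
qed

text \<open>The homogeneous polynomials of degree \<open>n\<close>, encoded as combinations of n-th
  powers of linear forms because the Fischer product is computed from such a representation.\<close>

definition form :: "nat \<Rightarrow> ('a::euclidean_space \<Rightarrow> real) \<Rightarrow> bool"
  where "form n p \<longleftrightarrow> (\<exists>r. \<forall>z. p z = comb r (\<lambda>w. (w \<bullet> z) ^ n))"

lemma formI: "(\<And>z. p z = comb r (\<lambda>w. (w \<bullet> z) ^ n)) \<Longrightarrow> form n p"
  unfolding form_def by blast

lemma form_0: "form n (\<lambda>z. 0)"
  by (rule formI [of _ "[]"]) simp

lemma form_const: "form 0 (\<lambda>z. c)"
  by (rule formI [of _ "[(c, 0)]"]) simp

lemma form_add:
  assumes "form n p" "form n q"
  shows "form n (\<lambda>z. p z + q z)"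
proof -
  obtain r s where "\<And>z. p z = comb r (\<lambda>w. (w \<bullet> z) ^ n)" "\<And>z. q z = comb s (\<lambda>w. (w \<bullet> z) ^ n)"
    using assms unfolding form_def by blast
  then show ?thesis
    by (intro formI [of _ "r @ s"]) simp
qed

lemma form_cmult:
  assumes "form n p"
  shows "form n (\<lambda>z. c * p z)"
proof -
  obtain r where "\<And>z. p z = comb r (\<lambda>w. (w \<bullet> z) ^ n)"
    using assms unfolding form_def by blast
  then show ?thesis
    by (intro formI [of _ "map (\<lambda>(d, w). (c * d, w)) r"]) (simp add: comb_scale)
qed

lemma form_sum: "(\<And>i. i \<in> I \<Longrightarrow> form n (p i)) \<Longrightarrow> form n (\<lambda>z. \<Sum>i\<in>I. p i z)"
  by (induction I rule: infinite_finite_induct) (auto intro: form_0 form_add)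

lemma form_comb: "(\<And>w. form n (p w)) \<Longrightarrow> form n (\<lambda>z. comb r (\<lambda>w. p w z))"
  by (induction r) (auto intro!: form_0 form_add form_cmult)

section \<open>Coefficients of polynomials and multiplication of forms\<close>

lemma coeff_eq_sum_values:
  "\<exists>l. \<forall>p :: real poly. degree p \<le> n \<longrightarrow> coeff p i = (\<Sum>t\<le>n. l t * poly p (real t))"
proof -
  \<comment> \<open>Lagrange basis polynomials for the nodes 0, ..., n; their coefficients are
    weights that do not depend on \<open>p\<close>.\<close>
  define L where "L t = (\<Prod>s\<in>{..n} - {t}. smult (1 / (real t - real s)) [:- real s, 1:])" for t
  have Lp: "poly (L t) (real u) = (if u = t then 1 else 0)" if "t \<le> n" "u \<le> n" for t u
  proof -
    have "poly (L t) (real u) = (\<Prod>s\<in>{..n} - {t}. (real u - real s) / (real t - real s))"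
      by (simp add: L_def poly_prod diff_divide_distrib)
    also have "\<dots> = (if u = t then 1 else 0)"
      using that by (auto intro!: prod.neutral prod_zero)
    finally show ?thesis .
  qed
  have Ld: "degree (L t) \<le> n" if "t \<le> n" for t
  proof -
    have "degree (L t) \<le> (\<Sum>s\<in>{..n} - {t}. degree (smult (1 / (real t - real s)) [:- real s, 1:]))"
      unfolding L_def by (rule degree_prod_sum_le [unfolded o_def]) simp
    also have "\<dots> \<le> (\<Sum>s\<in>{..n} - {t}. 1)"
      by (rule sum_mono) auto
    also have "\<dots> = n" using that by simp
    finally show ?thesis .
  qed
  have "p = (\<Sum>t\<le>n. smult (poly p (real t)) (L t))" if "degree p \<le> n" for p :: "real poly"
  proof (rule poly_eqI_degree [of "real ` {..n}"])
    fix x assume "x \<in> real ` {..n}"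
    then obtain u where u: "u \<le> n" "x = real u" by auto
    have "(\<Sum>t\<le>n. poly p (real t) * poly (L t) (real u)) = (\<Sum>t\<le>n. if t = u then poly p (real u) else 0)"
      using u by (intro sum.cong) (auto simp: Lp)
    then show "poly p x = poly (\<Sum>t\<le>n. smult (poly p (real t)) (L t)) x"
      using u by (simp add: poly_sum)
  next
    have "degree (\<Sum>t\<le>n. smult (poly p (real t)) (L t)) \<le> n"
      using Ld by (intro degree_sum_le) (auto intro: order_trans [OF degree_smult_le])
    then show "degree (\<Sum>t\<le>n. smult (poly p (real t)) (L t)) < card (real ` {..n})"
      by (simp add: card_image)
  qed (use that in \<open>simp add: card_image\<close>)
  then have "coeff p i = (\<Sum>t\<le>n. coeff (L t) i * poly p (real t))" if "degree p \<le> n" for p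
  proof -
    have "coeff p i = coeff (\<Sum>t\<le>n. smult (poly p (real t)) (L t)) i"
      using \<open>\<And>p. degree p \<le> n \<Longrightarrow> p = _\<close> [OF that] by (rule arg_cong)
    then show ?thesis by (simp add: coeff_sum mult.commute)
  qed
  then show ?thesis by (intro exI [of _ "\<lambda>t. coeff (L t) i"]) blast
qed

lemma coeff_power_1: "coeff (q ^ n) 1 = real n * coeff q 0 ^ (n - 1) * coeff q 1"
proof (induction n)
  case (Suc n)
  have "coeff (q ^ Suc n) 1 = coeff q 0 * coeff (q ^ n) 1 + coeff q 1 * coeff q 0 ^ n"
    by (simp add: coeff_mult coeff_0_power)
  then show ?case unfolding Suc
    by (cases n) (simp_all add: algebra_simps)
qed simp

lemma coeff_mult_2:
  "coeff (p * q) 2 = coeff p 0 * coeff q 2 + coeff p 1 * coeff q 1 + coeff p 2 * (coeff q 0 :: real)"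
  by (simp add: coeff_mult numeral_2_eq_2)

text \<open>Truncation in \<open>n - 1\<close> and \<open>n - 2\<close> is harmless: the factors n
  and n (n - 1) vanish where it occurs.\<close>

lemma coeff_power_2:
  "coeff (q ^ n) 2 = real n * coeff q 0 ^ (n - 1) * coeff q 2
    + real n * (real n - 1) / 2 * coeff q 0 ^ (n - 2) * (coeff q 1)\<^sup>2"
proof (induction n)
  case (Suc n)
  have "coeff (q ^ Suc n) 2 = coeff q 0 * coeff (q ^ n) 2 + coeff q 1 * coeff (q ^ n) 1 + coeff q 2 * coeff q 0 ^ n"
    by (simp add: coeff_mult_2 coeff_0_power)
  also have "\<dots> = real (Suc n) * coeff q 0 ^ (Suc n - 1) * coeff q 2
    + real (Suc n) * (real (Suc n) - 1) / 2 * coeff q 0 ^ (Suc n - 2) * (coeff q 1)\<^sup>2"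
  proof (cases n)
    case (Suc m)
    then show ?thesis unfolding \<open>coeff (q ^ n) 2 = _\<close> coeff_power_1
      by (cases m) (auto simp: field_simps power2_eq_square)
  qed (simp add: coeff_power_1)
  finally show ?case .
qed simp

text \<open>Polarisation: (n + 1) (e \<bullet> z) (w \<bullet> z)^n is the coefficient of t in ((w +
  t e) \<bullet> z)^(n + 1), hence a fixed combination of the values at t = 0, ..., n + 1, each a
  power of a linear form.\<close>

lemma form_linear_mult:
  assumes "form n p"
  shows "form (Suc n) (\<lambda>z. (e \<bullet> z) * p z)"
proof -
  have pow: "form (Suc n) (\<lambda>z. (e \<bullet> z) * (w \<bullet> z) ^ n)" for w
  proof -
    obtain l where l: "\<And>p :: real poly. degree p \<le> Suc n \<Longrightarrow>
        coeff p 1 = (\<Sum>t\<le>Suc n. l t * poly p (real t))"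
      using coeff_eq_sum_values [of "Suc n" 1] by blast
    have "real (Suc n) * ((e \<bullet> z) * (w \<bullet> z) ^ n)
      = (\<Sum>t\<le>Suc n. l t * ((w + real t *\<^sub>R e) \<bullet> z) ^ Suc n)" for z
    proof -
      have "degree ([:w \<bullet> z, e \<bullet> z:] ^ Suc n) \<le> Suc n"
        by (rule order_trans [OF degree_power_le]) simp
      from l [OF this] show ?thesis
        unfolding coeff_power_1 by (simp add: algebra_simps inner_add_left)
    qed
    then have "(e \<bullet> z) * (w \<bullet> z) ^ n
      = (1 / real (Suc n)) * (\<Sum>t\<le>Suc n. l t * ((w + real t *\<^sub>R e) \<bullet> z) ^ Suc n)" for z
      by (simp add: field_simps del: of_nat_Suc sum.atMost_Suc)
    moreover have "form (Suc n) (\<lambda>z. (v \<bullet> z) ^ Suc n)" for v :: 'a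
      by (rule formI [of _ "[(1, v)]"]) simp
    ultimately show ?thesis
      by (simp only:) (intro form_cmult form_sum)
  qed
  obtain r where "\<And>z. p z = comb r (\<lambda>w. (w \<bullet> z) ^ n)"
    using assms unfolding form_def by blast
  then have "(e \<bullet> z) * p z = comb r (\<lambda>w. (e \<bullet> z) * (w \<bullet> z) ^ n)" for z
    by (simp add: comb_cmult)
  then show ?thesis
    using form_comb [OF pow, of r] by simp
qed

text \<open>Serves both |z|^2 and |<y,z>|^2, which are sums of squares of real linear forms in
  z.\<close>

lemma form_sum_squares_mult:
  assumes "form n p"
  shows "form (n + 2) (\<lambda>z. (\<Sum>i\<in>I. (u i \<bullet> z)\<^sup>2) * p z)"
proof -
  have "(\<lambda>z. (\<Sum>i\<in>I. (u i \<bullet> z)\<^sup>2) * p z) = (\<lambda>z. \<Sum>i\<in>I. (u i \<bullet> z) * ((u i \<bullet> z) * p z))"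
    by (simp add: sum_distrib_right power2_eq_square mult.assoc)
  then show ?thesis
    using assms by (auto intro!: form_sum form_linear_mult)
qed

lemma norm_square_eq_sum: "(norm z)\<^sup>2 = (\<Sum>b\<in>Basis. (b \<bullet> z)\<^sup>2)"
  unfolding power2_norm_eq_inner
  by (subst euclidean_inner) (simp add: power2_eq_square inner_commute)

lemma form_norm_mult: "form n p \<Longrightarrow> form (n + 2) (\<lambda>z. (norm z)\<^sup>2 * p z)"
  unfolding norm_square_eq_sum by (rule form_sum_squares_mult)

lemma form_norm_power: "form (2 * k) (\<lambda>z. (norm z) ^ (2 * k))"
proof (induction k)
  case (Suc k)
  from form_norm_mult [OF Suc] show ?case
    by (simp add: power2_eq_square mult.assoc)
qed (simp add: form_const)

section \<open>The Laplacian of a form\<close>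

text \<open>The left-hand side is half the Laplacian, read off along the lines \<open>v + t b\<close>.\<close>

lemma comb_laplacian:
  fixes v :: "'a::euclidean_space"
  assumes "\<And>b t. b \<in> Basis \<Longrightarrow> poly (P b) t = comb r (\<lambda>w. (w \<bullet> (v + t *\<^sub>R b)) ^ n)"
  shows "(\<Sum>b\<in>Basis. coeff (P b) 2)
    = real n * (real n - 1) / 2 * comb r (\<lambda>w. (norm w)\<^sup>2 * (w \<bullet> v) ^ (n - 2))"
proof -
  have P: "coeff (P b) 2 = comb r (\<lambda>w. real n * (real n - 1) / 2 * ((w \<bullet> v) ^ (n - 2) * (w \<bullet> b)\<^sup>2))"
    if "b \<in> Basis" for b
  proof -
    have "poly (\<Sum>(c, w)\<leftarrow>r. smult c ([:w \<bullet> v, w \<bullet> b:] ^ n)) t = comb r (\<lambda>w. (w \<bullet> (v + t *\<^sub>R b)) ^ n)" for t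
      by (induction r) (auto simp: inner_add_right)
    then have "P b = (\<Sum>(c, w)\<leftarrow>r. smult c ([:w \<bullet> v, w \<bullet> b:] ^ n))"
      using assms [OF that] by (intro poly_eq_poly_eq_iff [THEN iffD1] ext) simp
    moreover have "coeff ([:x, y:] ^ n) 2 = real n * (real n - 1) / 2 * (x ^ (n - 2) * y\<^sup>2)" for x y :: real
      using coeff_eq_0 [of "[:x, y:]" 2] by (simp add: coeff_power_2)
    then have "coeff (\<Sum>(c, w)\<leftarrow>r. smult c ([:w \<bullet> v, w \<bullet> b:] ^ n)) 2
      = comb r (\<lambda>w. real n * (real n - 1) / 2 * ((w \<bullet> v) ^ (n - 2) * (w \<bullet> b)\<^sup>2))"
      by (induction r) auto
    ultimately show ?thesis by simp
  qed
  have "(\<Sum>b\<in>Basis. coeff (P b) 2)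
    = comb r (\<lambda>w. \<Sum>b\<in>Basis. real n * (real n - 1) / 2 * ((w \<bullet> v) ^ (n - 2) * (w \<bullet> b)\<^sup>2))"
    by (simp add: P comb_sum)
  \<comment> \<open>The squared coordinates add up to |w|^2, so the Laplacian at \<open>v\<close> is
    a multiple of the Fischer product with |z|^2 (v \<bullet> z)^(n - 2).\<close>
  also have "\<dots> = comb r (\<lambda>w. real n * (real n - 1) / 2 * ((norm w)\<^sup>2 * (w \<bullet> v) ^ (n - 2)))"
    by (simp add: norm_square_eq_sum sum_distrib_left sum_distrib_right inner_commute mult_ac)
  finally show ?thesis by (simp only: comb_cmult)
qed

section \<open>Zonal kernels of projective spaces\<close>

text \<open>Treats the three scalar algebras at once. The axiom says that left multiplication by
  \<open>conjg a\<close> is adjoint to left multiplication by \<open>a\<close> for the real inner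
  product.\<close>

class hermitian_scalar = conjugation + real_normed_div_algebra + euclidean_space +
  assumes inner_mult_conjg: "inner (a * g) b = inner g (conjg a * b)"

instance real :: hermitian_scalar
  by standard (simp add: conjg_real_def)

instance complex :: hermitian_scalar
  by standard (simp add: conjg_complex_def inner_complex_def algebra_simps)

instance quat :: hermitian_scalar
  by standard (simp add: conjg_quat_def inner_quat_def algebra_simps)

text \<open>Scalars act on the right, which matters for quaternions: \<open>hprod x\<close> is right
  linear in its second argument.\<close>

definition rmul :: "'k::times ^ 'n \<Rightarrow> 'k \<Rightarrow> 'k ^ 'n"
  where "rmul y g = (\<chi> i. y $ i * g)"

text \<open>Links the real and the Hermitian structure: the real coordinates of <y,z> are the linear
  forms \<open>inner (rmul y e)\<close>, for \<open>e\<close> in the basis.\<close>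

lemma inner_rmul: "inner (rmul y g) z = inner g (hprod (y :: 'k::hermitian_scalar ^ 'n) z)"
  by (simp add: inner_vec_def rmul_def hprod_def inner_sum_right inner_mult_conjg)

lemma norm_rmul: "norm (rmul (y :: 'k::real_normed_div_algebra ^ 'n) g) = norm y * norm g"
proof -
  have "(norm (rmul y g))\<^sup>2 = (norm y * norm g)\<^sup>2"
    by (simp add: power2_norm_vec rmul_def norm_mult power_mult_distrib sum_distrib_right)
  then show ?thesis by simp
qed

lemma hprod_rmul: "hprod x (rmul y g) = hprod x y * (g :: 'k::{conjugation, semiring_0})"
  by (simp add: hprod_def rmul_def sum_distrib_right mult.assoc)

lemma hprod_add_scaleR:
  fixes x :: "'k::{conjugation, real_normed_algebra} ^ 'n"
  shows "hprod x (y + t *\<^sub>R z) = hprod x y + t *\<^sub>R hprod x z"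
  by (simp add: hprod_def algebra_simps sum.distrib scaleR_right.sum)

text \<open>Multiplying x by the scalar h = <x,y> turns the real inner product with y into |h|^2, so
  the real Cauchy-Schwarz inequality applies.\<close>

lemma norm_hprod_le: "norm (hprod x y) \<le> norm x * norm (y :: 'k::hermitian_scalar ^ 'n)"
proof -
  let ?h = "hprod x y"
  have "(norm ?h)\<^sup>2 = inner (rmul x ?h) y"
    by (simp add: inner_rmul power2_norm_eq_inner)
  also have "\<dots> \<le> norm (rmul x ?h) * norm y"
    by (rule norm_cauchy_schwarz)
  finally have "norm ?h * norm ?h \<le> (norm x * norm y) * norm ?h"
    by (simp add: norm_rmul power2_eq_square mult_ac)
  then show ?thesis
    by (cases "norm ?h = 0") (auto dest: mult_right_le_imp_le)
qed

text \<open>With h = <x,y>, |h|^2 is the real inner product of y and x h, hence of 1 and <y,x> h,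
  and so at most |<y,x>| |h|. Exchanging x and y gives equality.\<close>

lemma norm_hprod_commute: "norm (hprod x y) = norm (hprod y (x :: 'k::hermitian_scalar ^ 'n))"
proof -
  have "norm (hprod x y) \<le> norm (hprod y x)" for x y :: "'k ^ 'n"
  proof -
    let ?h = "hprod x y"
    have "(norm ?h)\<^sup>2 = inner (rmul x ?h) y"
      by (simp add: inner_rmul power2_norm_eq_inner)
    also have "\<dots> = inner (rmul y 1) (rmul x ?h)"
      by (simp add: inner_commute rmul_def)
    also have "\<dots> = inner 1 (hprod y x * ?h)"
      by (simp add: inner_rmul hprod_rmul)
    also have "\<dots> \<le> norm (hprod y x) * norm ?h"
      using norm_cauchy_schwarz [of 1 "hprod y x * ?h"] by (simp add: norm_mult)
    finally show ?thesis
      by (cases "norm ?h = 0") (auto simp: power2_eq_square dest: mult_right_le_imp_le)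
  qed
  then show ?thesis by (blast intro: antisym)
qed

lemma hprod_norm_square_eq_sum:
  "(norm (hprod (y :: 'k::hermitian_scalar ^ 'n) z))\<^sup>2 = (\<Sum>e\<in>Basis. (inner (rmul y e) z)\<^sup>2)"
  by (simp add: norm_square_eq_sum inner_rmul)

lemma norm_hprod_self: "norm (hprod y y) = (norm (y :: 'k::hermitian_scalar ^ 'n))\<^sup>2"
proof (rule antisym)
  show "norm (hprod y y) \<le> (norm y)\<^sup>2"
    using norm_hprod_le [of y y] by (simp add: power2_eq_square)
  have "(norm y)\<^sup>2 = inner (rmul y 1) y"
    by (simp add: rmul_def power2_norm_eq_inner)
  also have "\<dots> \<le> norm (hprod y y)"
    using norm_cauchy_schwarz [of 1 "hprod y y"] by (simp add: inner_rmul)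
  finally show "(norm y)\<^sup>2 \<le> norm (hprod y y)" .
qed

lemma form_hprod_mult:
  "form n p \<Longrightarrow> form (n + 2) (\<lambda>z. (norm (hprod (y :: 'k::hermitian_scalar ^ 'n) z))\<^sup>2 * p z)"
  unfolding hprod_norm_square_eq_sum by (rule form_sum_squares_mult)

section \<open>Zonal kernels as forms\<close>

lemma form_zonal_term:
  fixes x :: "'k::hermitian_scalar ^ 'n"
  shows "form (2 * (s + l)) (\<lambda>z. ((norm (hprod x z))\<^sup>2 - c * (norm z)\<^sup>2) ^ s * ((norm (hprod x z))\<^sup>2) ^ l)"
proof (induction s)
  case 0
  show ?case
  proof (induction l)
    case (Suc l)
    from form_hprod_mult [OF Suc, of x] show ?case by simp
  qed (simp add: form_const)
next
  case (Suc s)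
  from form_add [OF form_hprod_mult [OF Suc, of x] form_cmult [OF form_norm_mult [OF Suc], of "- c"]]
  show ?case by (simp add: algebra_simps)
qed

text \<open>The explicit Jacobi sum at 2 t^2 - 1, made homogeneous through t = |<x,z>| / (|x| |z|),
  with coefficients \<open>a\<close> left open.\<close>

definition zonal_kernel :: "(nat \<Rightarrow> real) \<Rightarrow> nat \<Rightarrow> 'k::hermitian_scalar ^ 'n \<Rightarrow> 'k ^ 'n \<Rightarrow> real"
  where "zonal_kernel a k x z =
    (\<Sum>s\<le>k. a s * (((norm (hprod x z))\<^sup>2 - (norm x)\<^sup>2 * (norm z)\<^sup>2) ^ s * ((norm (hprod x z))\<^sup>2) ^ (k - s)))"

lemma form_zonal_kernel: "form (2 * k) (zonal_kernel a k x)"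
proof -
  have "form (2 * k) (\<lambda>z. a s * (((norm (hprod x z))\<^sup>2 - (norm x)\<^sup>2 * (norm z)\<^sup>2) ^ s * ((norm (hprod x z))\<^sup>2) ^ (k - s)))"
    if "s \<le> k" for s
    using form_cmult [OF form_zonal_term [of s "k - s" x "(norm x)\<^sup>2"]] that by simp
  then show ?thesis
    unfolding zonal_kernel_def [abs_def] by (intro form_sum) auto
qed

text \<open>|<x,y>|^2 and |y|^2 both scale by |g|^2. This is the invariance under unit scalars that
  lets a pairing over the scalars evaluate the kernel.\<close>

lemma zonal_kernel_rmul:
  "zonal_kernel a k x (rmul y g) = norm g ^ (2 * k) * zonal_kernel a k x y"
proof -
  have "(((norm (hprod x (rmul y g)))\<^sup>2 - (norm x)\<^sup>2 * (norm (rmul y g))\<^sup>2) ^ s * ((norm (hprod x (rmul y g)))\<^sup>2) ^ (k - s))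
    = norm g ^ (2 * k) * (((norm (hprod x y))\<^sup>2 - (norm x)\<^sup>2 * (norm y)\<^sup>2) ^ s * ((norm (hprod x y))\<^sup>2) ^ (k - s))"
    if "s \<le> k" for s
  proof -
    have "(norm (hprod x (rmul y g)))\<^sup>2 = (norm g)\<^sup>2 * (norm (hprod x y))\<^sup>2"
      by (simp add: hprod_rmul norm_mult power_mult_distrib)
    moreover have "(norm (hprod x (rmul y g)))\<^sup>2 - (norm x)\<^sup>2 * (norm (rmul y g))\<^sup>2
      = (norm g)\<^sup>2 * ((norm (hprod x y))\<^sup>2 - (norm x)\<^sup>2 * (norm y)\<^sup>2)"
      by (simp add: hprod_rmul norm_rmul norm_mult power_mult_distrib algebra_simps)
    moreover have "norm g ^ (2 * k) = ((norm g)\<^sup>2) ^ s * ((norm g)\<^sup>2) ^ (k - s)"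
      using that by (simp flip: power_add power_mult distrib_left)
    ultimately show ?thesis
      by (simp only: power_mult_distrib mult_ac)
  qed
  then show ?thesis
    by (simp add: zonal_kernel_def sum_distrib_left mult.left_commute)
qed

section \<open>Harmonicity of the zonal kernels\<close>

text \<open>
  Half the Laplacian of \<open>u\<^sup>s \<kappa>\<^sup>l\<close>, for \<open>\<kappa> = |\<langle>x,z\<rangle>|\<^sup>2\<close> and \<open>u = \<kappa> - |x|\<^sup>2|z|\<^sup>2\<close>. There is no mixed term
  because the gradients of \<open>u\<close> and \<open>\<kappa>\<close> are orthogonal.
\<close>

lemma zonal_term_laplacian:
  fixes x v :: "'k::hermitian_scalar ^ 'n" and D m X \<kappa> u :: real
  defines "D \<equiv> real DIM('k ^ 'n)" and "m \<equiv> real DIM('k)" and "X \<equiv> (norm x)\<^sup>2"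
    and "\<kappa> \<equiv> (norm (hprod x v))\<^sup>2" and "u \<equiv> \<kappa> - X * (norm v)\<^sup>2"
  defines "U \<equiv> \<lambda>b. [:u, 2 * (inner (hprod x v) (hprod x b) - X * inner v b), (norm (hprod x b))\<^sup>2 - X:]"
    and "V \<equiv> \<lambda>b. [:\<kappa>, 2 * inner (hprod x v) (hprod x b), (norm (hprod x b))\<^sup>2:]"
  shows "(\<Sum>b\<in>Basis. coeff (U b ^ s * V b ^ l) 2)
    = X * (real l * (m + 2 * real l - 2) * (u ^ s * \<kappa> ^ (l - 1))
      - real s * (D - m + 2 * real s - 2) * (u ^ (s - 1) * \<kappa> ^ l))"
proof -
  \<comment> \<open>\<open>U b\<close> and \<open>V b\<close> are u and \<kappa> along the line v +
    t b for a unit vector b; \<beta>, \<gamma> and \<delta> name the ingredients of their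
    coefficients.\<close>
  define \<beta> where "\<beta> b = inner (hprod x v) (hprod x b)" for b
  define \<gamma> where "\<gamma> b = (norm (hprod x b))\<^sup>2" for b
  define \<delta> where "\<delta> b = inner v b" for b
  have \<beta>: "\<beta> b = inner (rmul x (hprod x v)) b" for b
    by (simp add: \<beta>_def inner_rmul)
  have s1: "(\<Sum>b\<in>Basis. \<gamma> b) = m * X"
  proof -
    have "(\<Sum>b\<in>Basis. \<gamma> b) = (\<Sum>e\<in>Basis. \<Sum>b\<in>Basis. (inner (rmul x e) b)\<^sup>2)"
      unfolding \<gamma>_def hprod_norm_square_eq_sum by (rule sum.swap)
    also have "\<dots> = (\<Sum>e\<in>(Basis :: 'k set). (norm (rmul x e))\<^sup>2)"
      by (simp add: norm_square_eq_sum inner_commute)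
    also have "\<dots> = m * X"
      by (simp add: norm_rmul m_def X_def)
    finally show ?thesis .
  qed
  have s2: "(\<Sum>b\<in>Basis. (\<beta> b)\<^sup>2) = X * \<kappa>"
  proof -
    have "(\<Sum>b\<in>Basis. (\<beta> b)\<^sup>2) = (norm (rmul x (hprod x v)))\<^sup>2"
      unfolding \<beta> by (simp add: norm_square_eq_sum inner_commute)
    then show ?thesis by (simp add: norm_rmul X_def \<kappa>_def power_mult_distrib)
  qed
  have s3: "(\<Sum>b\<in>Basis. \<beta> b * \<delta> b) = \<kappa>"
  proof -
    have "(\<Sum>b\<in>Basis. \<beta> b * \<delta> b) = inner (rmul x (hprod x v)) v"
      unfolding \<beta> \<delta>_def by (rule euclidean_inner [symmetric])
    then show ?thesis by (simp add: inner_rmul \<kappa>_def power2_norm_eq_inner)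
  qed
  have s4: "(\<Sum>b\<in>Basis. (\<delta> b)\<^sup>2) = (norm v)\<^sup>2"
    unfolding \<delta>_def by (simp add: norm_square_eq_sum inner_commute)
  have t2: "(\<Sum>b\<in>Basis. (\<beta> b - X * \<delta> b)\<^sup>2) = - X * u"
  proof -
    have "(\<Sum>b\<in>Basis. (\<beta> b - X * \<delta> b)\<^sup>2)
      = (\<Sum>b\<in>Basis. (\<beta> b)\<^sup>2) - 2 * X * (\<Sum>b\<in>Basis. \<beta> b * \<delta> b) + X\<^sup>2 * (\<Sum>b\<in>Basis. (\<delta> b)\<^sup>2)"
      by (simp add: power2_diff sum.distrib sum_subtractf sum_distrib_left algebra_simps power_mult_distrib)
    then show ?thesis
      unfolding s2 s3 s4 u_def by (simp add: algebra_simps power2_eq_square)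
  qed
  \<comment> \<open>Up to the factor 2, \<open>\<beta> b - X * \<delta> b\<close> and
    \<open>\<beta> b\<close> are the coordinates of the gradients of u and \<kappa>; this is their
    orthogonality.\<close>
  have t3: "(\<Sum>b\<in>Basis. (\<beta> b - X * \<delta> b) * \<beta> b) = 0"
  proof -
    have "(\<Sum>b\<in>Basis. (\<beta> b - X * \<delta> b) * \<beta> b) = (\<Sum>b\<in>Basis. (\<beta> b)\<^sup>2) - X * (\<Sum>b\<in>Basis. \<beta> b * \<delta> b)"
      by (simp add: sum_subtractf sum_distrib_left algebra_simps power2_eq_square)
    then show ?thesis unfolding s2 s3 by simp
  qed
  have t1: "(\<Sum>b\<in>Basis. \<gamma> b - X) = m * X - D * X"
    by (simp add: sum_subtractf s1 D_def)
  \<comment> \<open>The extra factor c raises the truncated exponent correctly for n at least 2;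
    below that, n (n - 1) = 0.\<close>
  have lower: "real n * (real n - 1) * c ^ (n - 2) * c = real n * (real n - 1) * c ^ (n - 1)" for n and c :: real
  proof (cases n)
    case (Suc i)
    then show ?thesis by (cases i) auto
  qed simp
  have "coeff (U b ^ s * V b ^ l) 2
    = u ^ s * real l * \<kappa> ^ (l - 1) * \<gamma> b
      + u ^ s * 2 * real l * (real l - 1) * \<kappa> ^ (l - 2) * (\<beta> b)\<^sup>2
      + 4 * real s * u ^ (s - 1) * real l * \<kappa> ^ (l - 1) * ((\<beta> b - X * \<delta> b) * \<beta> b)
      + \<kappa> ^ l * real s * u ^ (s - 1) * (\<gamma> b - X)
      + \<kappa> ^ l * 2 * real s * (real s - 1) * u ^ (s - 2) * (\<beta> b - X * \<delta> b)\<^sup>2" for b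
  proof -
    define \<epsilon> where "\<epsilon> = \<beta> b - X * \<delta> b"
    have U: "coeff (U b) 0 = u" "coeff (U b) 1 = 2 * \<epsilon>" "coeff (U b) 2 = \<gamma> b - X"
      by (simp_all add: U_def \<beta>_def \<gamma>_def \<delta>_def \<epsilon>_def numeral_2_eq_2)
    have V: "coeff (V b) 0 = \<kappa>" "coeff (V b) 1 = 2 * \<beta> b" "coeff (V b) 2 = \<gamma> b"
      by (simp_all add: V_def \<beta>_def \<gamma>_def numeral_2_eq_2)
    show ?thesis
      unfolding coeff_mult_2 coeff_power_2 coeff_power_1 coeff_0_power U V \<epsilon>_def [symmetric]
      by (simp add: power_mult_distrib field_simps)
  qed
  then have "(\<Sum>b\<in>Basis. coeff (U b ^ s * V b ^ l) 2)
    = u ^ s * real l * \<kappa> ^ (l - 1) * (m * X)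
      + u ^ s * 2 * real l * (real l - 1) * \<kappa> ^ (l - 2) * (X * \<kappa>)
      + \<kappa> ^ l * real s * u ^ (s - 1) * (m * X - D * X)
      + \<kappa> ^ l * 2 * real s * (real s - 1) * u ^ (s - 2) * (- X * u)"
    by (simp only: sum.distrib sum_distrib_left [symmetric] s1 s2 t1 t2 t3)
  also have "\<dots> = X * (real l * m * (u ^ s * \<kappa> ^ (l - 1))
      + 2 * u ^ s * (real l * (real l - 1) * \<kappa> ^ (l - 2) * \<kappa>)
      - real s * (D - m) * (u ^ (s - 1) * \<kappa> ^ l)
      - 2 * \<kappa> ^ l * (real s * (real s - 1) * u ^ (s - 2) * u))"
    by (simp add: algebra_simps)
  also have "real l * (real l - 1) * \<kappa> ^ (l - 2) * \<kappa> = real l * (real l - 1) * \<kappa> ^ (l - 1)"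
    by (rule lower)
  also have "real s * (real s - 1) * u ^ (s - 2) * u = real s * (real s - 1) * u ^ (s - 1)"
    by (rule lower)
  finally show ?thesis by (simp add: algebra_simps)
qed

text \<open>The conclusion is, up to a positive factor, that the Laplacian of the kernel vanishes at
  \<open>v\<close>. The recursion \<open>rec\<close> makes the Laplacians of the summands
  telescope.\<close>

lemma zonal_kernel_harmonic:
  fixes x v :: "'k::hermitian_scalar ^ 'n"
  assumes rec: "\<And>s. s < k \<Longrightarrow>
      a (Suc s) * real (Suc s) * (real DIM('k ^ 'n) - real DIM('k) + 2 * real s)
      = a s * real (k - s) * (real DIM('k) + 2 * real (k - s) - 2)"
    and "k \<ge> 1"
    and r: "\<And>z. zonal_kernel a k x z = comb r (\<lambda>w. (inner w z) ^ (2 * k))"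
  shows "comb r (\<lambda>w. (norm w)\<^sup>2 * (inner w v) ^ (2 * k - 2)) = 0"
proof -
  define X where "X = (norm x)\<^sup>2"
  define \<kappa> where "\<kappa> = (norm (hprod x v))\<^sup>2"
  define u where "u = \<kappa> - X * (norm v)\<^sup>2"
  define U where "U b = [:u, 2 * (inner (hprod x v) (hprod x b) - X * inner v b), (norm (hprod x b))\<^sup>2 - X:]" for b
  define V where "V b = [:\<kappa>, 2 * inner (hprod x v) (hprod x b), (norm (hprod x b))\<^sup>2:]" for b
  \<comment> \<open>Up to sign and the factor X, the part of the Laplacian of summand s in which the
    power of u drops. By \<open>rec\<close>, the part in which the power of \<kappa> drops is
    \<open>g (Suc s)\<close>.\<close>
  define g where "g s = a s * real s * (real DIM('k ^ 'n) - real DIM('k) + 2 * real s - 2) * (u ^ (s - 1) * \<kappa> ^ (k - s))" for s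
  have P: "poly (\<Sum>s\<le>k. smult (a s) (U b ^ s * V b ^ (k - s))) t
      = comb r (\<lambda>w. (inner w (v + t *\<^sub>R b)) ^ (2 * k))" if "b \<in> Basis" for b t
  proof -
    have V: "poly (V b) t = (norm (hprod x (v + t *\<^sub>R b)))\<^sup>2"
      unfolding hprod_add_scaleR power2_norm_eq_inner
      by (simp add: V_def \<kappa>_def power2_norm_eq_inner inner_add_left inner_add_right inner_commute algebra_simps)
    have "(norm (v + t *\<^sub>R b))\<^sup>2 = (norm v)\<^sup>2 + 2 * t * inner v b + t\<^sup>2"
      unfolding power2_norm_eq_inner using that
      by (simp add: inner_add_left inner_add_right inner_commute algebra_simps power2_eq_square)
    then have U: "poly (U b) t = (norm (hprod x (v + t *\<^sub>R b)))\<^sup>2 - X * (norm (v + t *\<^sub>R b))\<^sup>2"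
      unfolding V [symmetric] by (simp add: U_def V_def u_def algebra_simps power2_eq_square)
    show ?thesis
      by (simp add: r [symmetric] zonal_kernel_def poly_sum U V X_def)
  qed
  have "real (2 * k) * (real (2 * k) - 1) / 2 * comb r (\<lambda>w. (norm w)\<^sup>2 * (inner w v) ^ (2 * k - 2))
    = (\<Sum>b\<in>Basis. coeff (\<Sum>s\<le>k. smult (a s) (U b ^ s * V b ^ (k - s))) 2)"
    by (rule comb_laplacian [OF P, symmetric])
  also have "\<dots> = (\<Sum>s\<le>k. a s * (\<Sum>b\<in>Basis. coeff (U b ^ s * V b ^ (k - s)) 2))"
    by (simp add: coeff_sum sum_distrib_left) (rule sum.swap)
  also have "\<dots> = (\<Sum>s\<le>k. X * ((if s < k then g (Suc s) else 0) - g s))"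
  proof (intro sum.cong refl)
    fix s assume "s \<in> {..k}"
    have "a s * (\<Sum>b\<in>Basis. coeff (U b ^ s * V b ^ (k - s)) 2)
      = X * (a s * real (k - s) * (real DIM('k) + 2 * real (k - s) - 2) * (u ^ s * \<kappa> ^ (k - s - 1)) - g s)"
      unfolding U_def V_def u_def X_def \<kappa>_def g_def
      by (subst zonal_term_laplacian) (simp add: algebra_simps)
    also have "a s * real (k - s) * (real DIM('k) + 2 * real (k - s) - 2) * (u ^ s * \<kappa> ^ (k - s - 1))
      = (if s < k then g (Suc s) else 0)"
    proof (cases "s < k")
      case True
      have "real DIM('k ^ 'n) - real DIM('k) + 2 * real (Suc s) - 2 = real DIM('k ^ 'n) - real DIM('k) + 2 * real s"
        by simp
      with rec [OF True] True show ?thesis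
        unfolding g_def by (simp only: if_True diff_Suc_1 diff_Suc_eq_diff_pred diff_diff_left Suc_eq_plus1 add_diff_cancel_right')
    next
      case False
      then show ?thesis using \<open>s \<in> {..k}\<close> by simp
    qed
    finally show "a s * (\<Sum>b\<in>Basis. coeff (U b ^ s * V b ^ (k - s)) 2)
      = X * ((if s < k then g (Suc s) else 0) - g s)" .
  qed
  also have "\<dots> = X * ((\<Sum>s<k. g (Suc s) - g s) - g k)"
    unfolding lessThan_Suc_atMost [symmetric] by (simp add: sum_distrib_left right_diff_distrib)
  \<comment> \<open>What remains after telescoping is \<open>- g 0\<close>, and \<open>g 0\<close>
    contains the factor s = 0.\<close>
  also have "\<dots> = 0"
    by (simp add: sum_lessThan_telescope) (simp add: g_def)
  finally show ?thesis using \<open>k \<ge> 1\<close> by auto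
qed

text \<open>Z_y(z) is a positive multiple of the Fischer product of Z_y and Z_z, so the quadratic
  form is a positive multiple of the squared Fischer norm of the weighted sum of the forms Z at the
  points \<open>x i\<close>.\<close>

lemma zonal_kernel_nonneg:
  fixes x :: "'i \<Rightarrow> 'k::hermitian_scalar ^ 'n"
  assumes rec: "\<And>s. s < k \<Longrightarrow>
      a (Suc s) * real (Suc s) * (real DIM('k ^ 'n) - real DIM('k) + 2 * real s)
      = a s * real (k - s) * (real DIM('k) + 2 * real (k - s) - 2)"
    and k: "k \<ge> 1" and pos: "(\<Sum>s\<le>k. a s) > 0"
  shows "(\<Sum>i\<in>I. \<Sum>j\<in>I. w i * w j * zonal_kernel a k (x i) (x j)) \<ge> 0"
proof -
  let ?Z = "zonal_kernel a k :: 'k ^ 'n \<Rightarrow> _"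
  have "\<exists>\<zeta>. \<forall>y z. ?Z y z = comb (\<zeta> y) (\<lambda>w. (inner w z) ^ (2 * k))"
    using form_zonal_kernel unfolding form_def by metis
  then obtain \<zeta> where \<zeta>: "\<And>y z. ?Z y z = comb (\<zeta> y) (\<lambda>w. (inner w z) ^ (2 * k))"
    by blast
  \<comment> \<open>Pairing with |g|^(2k) on the scalars replaces an average over unit scalars;
    \<gamma> is the factor that it produces.\<close>
  obtain \<rho> :: "(real \<times> 'k) list" where \<rho>: "\<And>g. norm g ^ (2 * k) = comb \<rho> (\<lambda>h. (inner h g) ^ (2 * k))"
    using form_norm_power [of k] unfolding form_def by blast
  define \<gamma> where "\<gamma> = comb \<rho> (\<lambda>g. norm g ^ (2 * k))"
  have "\<gamma> \<ge> 1" \<comment> \<open>the Fischer norm of \<open>|g|\<^sup>2\<^sup>k - (e\<bullet>g)\<^sup>2\<^sup>k\<close> is nonnegative\<close>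
  proof -
    obtain e :: 'k where "e \<in> Basis" using nonempty_Basis by blast
    then have e: "norm e = 1" "inner e e = 1" by simp_all
    have "comb \<rho> (\<lambda>g. (inner e g) ^ (2 * k)) = 1" "comb \<rho> (\<lambda>g. (inner g e) ^ (2 * k)) = 1"
      using \<rho> [of e] by (simp_all add: e inner_commute)
    with comb_inner_power_nonneg [of "(- 1, e) # \<rho>" "2 * k"] show ?thesis
      by (simp add: comb_diff e \<gamma>_def \<rho> [symmetric])
  qed
  have pair: "(\<Sum>s\<le>k. a s) * \<gamma> * ?Z y z = comb (\<zeta> y) (?Z z)" for y z
  proof -
    let ?K = "\<lambda>w. (norm (hprod z w))\<^sup>2"
    \<comment> \<open>With \<kappa> = |<z,w>|^2, the difference \<kappa> - u = |z|^2 |w|^2 divides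
      \<kappa>^s - u^s. So a positive multiple of \<kappa>^k equals Z_z plus |w|^2
      \<open>q w\<close>.\<close>
    let ?u = "\<lambda>w. (norm (hprod z w))\<^sup>2 - (norm z)\<^sup>2 * (norm w)\<^sup>2"
    define q where "q w = (norm z)\<^sup>2 * (\<Sum>s\<le>k. a s * (\<Sum>i<s. ?u w ^ (s - Suc i) * ?K w ^ (i + (k - s))))" for w
    have q: "form (2 * k - 2) q"
      unfolding q_def [abs_def]
    proof (intro form_cmult form_sum)
      fix s i assume "s \<in> {..k}" "i \<in> {..<s}"
      then have "2 * k - 2 = 2 * ((s - Suc i) + (i + (k - s)))" by auto
      then show "form (2 * k - 2) (\<lambda>w. ?u w ^ (s - Suc i) * ?K w ^ (i + (k - s)))"
        using form_zonal_term [of "s - Suc i" "i + (k - s)" z "(norm z)\<^sup>2"] by simp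
    qed
    have split: "(\<Sum>s\<le>k. a s) * ?K w ^ k = ?Z z w + (norm w)\<^sup>2 * q w" for w
    proof -
      have "a s * ?K w ^ k = a s * (?u w ^ s * ?K w ^ (k - s))
          + (norm w)\<^sup>2 * ((norm z)\<^sup>2 * (a s * (\<Sum>i<s. ?u w ^ (s - Suc i) * ?K w ^ (i + (k - s)))))"
        if "s \<le> k" for s
      proof -
        have "?K w ^ s - ?u w ^ s = (norm z)\<^sup>2 * (norm w)\<^sup>2 * (\<Sum>i<s. ?u w ^ (s - Suc i) * ?K w ^ i)"
          using power_diff_sumr2 [of "?K w" s "?u w"] by simp
        then have "(?K w ^ s - ?u w ^ s) * ?K w ^ (k - s)
          = (norm z)\<^sup>2 * (norm w)\<^sup>2 * (\<Sum>i<s. ?u w ^ (s - Suc i) * ?K w ^ (i + (k - s)))"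
          by (simp add: sum_distrib_right power_add mult.assoc)
        moreover have "?K w ^ k = ?K w ^ s * ?K w ^ (k - s)"
          using that by (simp flip: power_add)
        ultimately have e: "?K w ^ k = ?u w ^ s * ?K w ^ (k - s)
            + (norm z)\<^sup>2 * (norm w)\<^sup>2 * (\<Sum>i<s. ?u w ^ (s - Suc i) * ?K w ^ (i + (k - s)))"
          by (simp only: left_diff_distrib)
        show ?thesis
          unfolding e by (simp only: distrib_left mult_ac)
      qed
      then show ?thesis
        by (simp add: sum_distrib_right sum_distrib_left zonal_kernel_def q_def flip: sum.distrib)
    qed
    obtain \<eta> where \<eta>: "\<And>w. q w = comb \<eta> (\<lambda>v. (inner v w) ^ (2 * k - 2))"
      using q unfolding form_def by blast
    \<comment> \<open>The Fischer product of Z_y with the multiple of |w|^2 vanishes, because Z_y is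
      harmonic.\<close>
    have "comb (\<zeta> y) (\<lambda>w. (norm w)\<^sup>2 * q w)
      = comb \<eta> (\<lambda>v. comb (\<zeta> y) (\<lambda>w. (norm w)\<^sup>2 * (inner w v) ^ (2 * k - 2)))"
      by (subst comb_swap) (simp add: \<eta> comb_cmult inner_commute)
    also have "\<dots> = 0"
      by (simp add: zonal_kernel_harmonic [OF rec k \<zeta>])
    finally have 0: "comb (\<zeta> y) (\<lambda>w. (norm w)\<^sup>2 * q w) = 0" .
    \<comment> \<open>Since the real inner product of w and z g is that of <z,w> and g, pairing over
      g turns its power into |<z,w>|^(2k).\<close>
    have "\<gamma> * ?Z y z = comb \<rho> (\<lambda>g. ?Z y (rmul z g))"
      by (simp add: zonal_kernel_rmul \<gamma>_def mult.commute comb_cmult [symmetric])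
    also have "\<dots> = comb (\<zeta> y) (\<lambda>w. comb \<rho> (\<lambda>g. (inner w (rmul z g)) ^ (2 * k)))"
      unfolding \<zeta> by (rule comb_swap)
    also have "\<dots> = comb (\<zeta> y) (\<lambda>w. ?K w ^ k)"
      unfolding power_mult [symmetric] by (subst inner_commute) (simp only: inner_rmul \<rho> [symmetric])
    finally have "(\<Sum>s\<le>k. a s) * \<gamma> * ?Z y z = comb (\<zeta> y) (\<lambda>w. (\<Sum>s\<le>k. a s) * ?K w ^ k)"
      by (simp add: comb_cmult)
    also have "\<dots> = comb (\<zeta> y) (?Z z)"
      unfolding split by (simp add: comb_add 0)
    finally show ?thesis .
  qed
  define p where "p z = (\<Sum>i\<in>I. w i * ?Z (x i) z)" for z
  have "form (2 * k) p"
    unfolding p_def [abs_def] by (intro form_sum form_cmult form_zonal_kernel)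
  then obtain R where R: "\<And>z. p z = comb R (\<lambda>w. (inner w z) ^ (2 * k))"
    unfolding form_def by blast
  have "0 \<le> comb R p"
    unfolding R by (rule comb_inner_power_nonneg)
  also have "comb R p = (\<Sum>i\<in>I. w i * comb R (?Z (x i)))"
    unfolding p_def [abs_def] by (simp add: comb_sum comb_cmult)
  also have "\<dots> = (\<Sum>i\<in>I. w i * comb (\<zeta> (x i)) p)"
    unfolding \<zeta> [abs_def] R [abs_def] by (subst comb_swap) (simp add: inner_commute)
  also have "\<dots> = (\<Sum>i\<in>I. \<Sum>j\<in>I. w i * w j * comb (\<zeta> (x i)) (?Z (x j)))"
    unfolding p_def [abs_def] by (simp add: comb_sum comb_cmult sum_distrib_left mult.assoc)
  also have "\<dots> = (\<Sum>s\<le>k. a s) * \<gamma> * (\<Sum>i\<in>I. \<Sum>j\<in>I. w i * w j * ?Z (x i) (x j))"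
    by (simp add: pair [symmetric] sum_distrib_left mult_ac)
  finally show ?thesis
    using mult_pos_pos [OF pos, of \<gamma>] \<open>\<gamma> \<ge> 1\<close> by (simp add: zero_le_mult_iff)
qed

section \<open>Jacobi coefficients and zonal functions\<close>

lemma gbinomial_pos_real:
  assumes "c > real j - 1"
  shows "((c :: real) gchoose j) > 0"
  unfolding gbinomial_prod_rev using assms by (intro divide_pos_pos prod_pos) auto

lemma gbinomial_Suc_mult:
  "((c :: real) gchoose (Suc j)) * real (Suc j) = (c gchoose j) * (c - real j)"
  using gbinomial_mult_1 [of c j] by algebra

text \<open>The Jacobi coefficients satisfy the recursion for harmonicity, and on unit vectors the
  kernel divided by the Jacobi value at 1 is the zonal function. Weight 0 accommodates the zero
  vectors of a frame.\<close>

lemma zonal_nonneg: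
  fixes x :: "'i \<Rightarrow> 'k::hermitian_scalar ^ 'n"
  assumes card: "CARD('n) \<ge> 2" and k: "k \<ge> 1"
    and unit: "\<And>i. i \<in> I \<Longrightarrow> w i = 0 \<or> norm (x i) = 1"
  shows "(\<Sum>i\<in>I. \<Sum>j\<in>I. w i * w j * zonal TYPE('k) CARD('n) k (norm (hprod (x i) (x j)))) \<ge> 0"
proof -
  define \<alpha> where "\<alpha> = (real CARD('n) - 1) * (real DIM('k) / 2) - 1"
  define \<beta> where "\<beta> = real DIM('k) / 2 - 1"
  define a where "a s = ((real k + \<alpha>) gchoose (k - s)) * ((real k + \<beta>) gchoose s)" for s
  have \<beta>: "\<beta> > - 1" by (simp add: \<beta>_def)
  have \<alpha>: "\<alpha> > - 1"
    using card by (simp add: \<alpha>_def)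
  have apos: "a s > 0" if "s \<le> k" for s
    unfolding a_def using that \<alpha> \<beta> by (intro mult_pos_pos gbinomial_pos_real) (auto simp: of_nat_diff)
  have jpos: "jacobi \<alpha> \<beta> k 1 > 0"
    unfolding jacobi_1 using \<alpha> by (intro gbinomial_pos_real) auto
  have rec: "a (Suc s) * real (Suc s) * (real DIM('k ^ 'n) - real DIM('k) + 2 * real s)
      = a s * real (k - s) * (real DIM('k) + 2 * real (k - s) - 2)" if "s < k" for s
  proof -
    define j where "j = k - Suc s"
    have j: "k - s = Suc j" using that by (simp add: j_def)
    have rj: "real k = real s + real j + 1" using j by linarith
    have G: "((real k + \<alpha>) gchoose (Suc j)) * real (Suc j) = ((real k + \<alpha>) gchoose j) * (\<alpha> + real s + 1)"
      unfolding gbinomial_Suc_mult by (simp add: rj)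
    have H: "((real k + \<beta>) gchoose (Suc s)) * real (Suc s) = ((real k + \<beta>) gchoose s) * (\<beta> + real (Suc j))"
      unfolding gbinomial_Suc_mult by (simp add: rj)
    \<comment> \<open>The real dimensions D of the space and m of the scalars satisfy D - m = 2
      (\<alpha> + 1) and m = 2 (\<beta> + 1).\<close>
    have d: "real DIM('k ^ 'n) - real DIM('k) + 2 * real s = 2 * (\<alpha> + real s + 1)"
      "real DIM('k) + 2 * real (k - s) - 2 = 2 * (\<beta> + real (Suc j))"
      by (simp_all add: \<alpha>_def \<beta>_def j field_simps)
    have "k - Suc s = j" using j by simp
    then have "a (Suc s) * real (Suc s) * (2 * (\<alpha> + real s + 1))
      = 2 * (((real k + \<alpha>) gchoose j) * (\<alpha> + real s + 1)) * (((real k + \<beta>) gchoose (Suc s)) * real (Suc s))"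
      by (simp add: a_def)
    also have "\<dots> = a s * real (k - s) * (2 * (\<beta> + real (Suc j)))"
      unfolding G [symmetric] H by (simp add: a_def j)
    finally show ?thesis unfolding d .
  qed
  have zonal: "zonal TYPE('k) CARD('n) k (norm (hprod u v)) = zonal_kernel a k u v / jacobi \<alpha> \<beta> k 1"
    if "norm u = 1" "norm v = 1" for u v :: "'k ^ 'n"
  proof -
    have "jacobi \<alpha> \<beta> k (2 * t\<^sup>2 - 1) = (\<Sum>s\<le>k. a s * ((t\<^sup>2 - 1) ^ s * (t\<^sup>2) ^ (k - s)))" for t
      unfolding jacobi_def a_def
    proof (intro sum.cong refl)
      fix s
      have "(2 * t\<^sup>2 - 1 - 1) / 2 = t\<^sup>2 - 1" "(2 * t\<^sup>2 - 1 + 1) / 2 = t\<^sup>2" by simp_all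
      then show "((real k + \<alpha>) gchoose (k - s)) * ((real k + \<beta>) gchoose s)
          * ((2 * t\<^sup>2 - 1 - 1) / 2) ^ s * ((2 * t\<^sup>2 - 1 + 1) / 2) ^ (k - s)
        = ((real k + \<alpha>) gchoose (k - s)) * ((real k + \<beta>) gchoose s) * ((t\<^sup>2 - 1) ^ s * (t\<^sup>2) ^ (k - s))"
        by (simp only: mult.assoc)
    qed
    moreover have "zonal TYPE('k) CARD('n) k t = jacobi \<alpha> \<beta> k (2 * t\<^sup>2 - 1) / jacobi \<alpha> \<beta> k 1" for t
      by (simp only: zonal_def Let_def \<alpha>_def \<beta>_def)
    ultimately show ?thesis
      using that by (simp add: zonal_kernel_def)
  qed
  have "(\<Sum>i\<in>I. \<Sum>j\<in>I. w i * w j * zonal TYPE('k) CARD('n) k (norm (hprod (x i) (x j))))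
    = (\<Sum>i\<in>I. \<Sum>j\<in>I. w i * w j * zonal_kernel a k (x i) (x j)) / jacobi \<alpha> \<beta> k 1"
    unfolding sum_divide_distrib
  proof (intro sum.cong refl)
    fix i j assume "i \<in> I" "j \<in> I"
    with unit [of i] unit [of j] show "w i * w j * zonal TYPE('k) CARD('n) k (norm (hprod (x i) (x j)))
        = w i * w j * zonal_kernel a k (x i) (x j) / jacobi \<alpha> \<beta> k 1"
      by (auto simp: zonal)
  qed
  moreover have "(\<Sum>i\<in>I. \<Sum>j\<in>I. w i * w j * zonal_kernel a k (x i) (x j)) \<ge> 0"
  proof (rule zonal_kernel_nonneg [OF rec k])
    show "(\<Sum>s\<le>k. a s) > 0" using apos by (intro sum_pos) auto
  qed
  ultimately show ?thesis using jpos by simp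
qed

section \<open>The bound for tight frames\<close>

text \<open>Convexity of \<open>exp\<close> between 0 and \<open>ln u\<close>. The case u = 0 uses
  the default \<open>0 powr s = 0\<close>, also at s = 0.\<close>

lemma powr_le_tangent:
  fixes u s :: real
  assumes "u \<ge> 0" "0 \<le> s" "s \<le> 1"
  shows "u powr s \<le> 1 + s * (u - 1)"
proof (cases "u = 0")
  case False
  with assms have "u > 0" by simp
  have "exp ((1 - s) *\<^sub>R 0 + s *\<^sub>R ln u) \<le> (1 - s) * exp 0 + s * exp (ln u)"
    using assms by (intro convex_onD [OF exp_convex]) auto
  then show ?thesis using \<open>u > 0\<close> by (simp add: powr_def algebra_simps)
qed (use assms in simp)

text \<open>The upper tangent bound with exponent 1/s, applied to \<open>u powr s\<close>.\<close>

lemma powr_ge_tangent: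
  fixes u s :: real
  assumes "u \<ge> 0" "1 \<le> s"
  shows "1 + s * (u - 1) \<le> u powr s"
proof -
  have "(u powr s) powr (1 / s) \<le> 1 + (1 / s) * (u powr s - 1)"
    using assms by (intro powr_le_tangent) auto
  moreover have "(u powr s) powr (1 / s) = u"
    using assms by (simp add: powr_powr)
  ultimately show ?thesis using assms by (simp add: field_simps)
qed

text \<open>The trace of the frame operator. It is taken over a real basis, which multiplies both
  sides by \<open>DIM('k)\<close>.\<close>

lemma tight_frame_sum_norm:
  fixes y :: "nat \<Rightarrow> 'k::hermitian_scalar ^ 'n"
  assumes "tight_frame N y A"
  shows "(\<Sum>i<N. (norm (y i))\<^sup>2) = A * real CARD('n)"
proof -
  have "(\<Sum>i<N. (norm (y i))\<^sup>2) * real DIM('k) = A * real CARD('n) * real DIM('k)"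
  proof -
    have "(\<Sum>i<N. (norm (y i))\<^sup>2) * real DIM('k) = (\<Sum>i<N. \<Sum>e\<in>(Basis :: 'k set). (norm (rmul (y i) e))\<^sup>2)"
      by (simp add: norm_rmul sum_distrib_left mult.commute [of _ "real DIM('k)"])
    also have "\<dots> = (\<Sum>i<N. \<Sum>b\<in>Basis. (norm (hprod (y i) b))\<^sup>2)"
      unfolding hprod_norm_square_eq_sum
      by (subst sum.swap [of _ Basis Basis]) (simp add: norm_square_eq_sum inner_commute)
    also have "\<dots> = (\<Sum>b\<in>Basis. \<Sum>i<N. (norm (hprod b (y i)))\<^sup>2)"
      by (subst sum.swap) (simp add: norm_hprod_commute [of _ "y _"])
    also have "\<dots> = (\<Sum>b\<in>(Basis :: ('k ^ 'n) set). A)"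
      using assms unfolding tight_frame_def by (intro sum.cong) auto
    finally show ?thesis by simp
  qed
  then show ?thesis by simp
qed

text \<open>If a vector is zero, both sides are 0, as division by 0 gives 0.\<close>

lemma norm_hprod_normalized:
  "norm (hprod (x /\<^sub>R norm x) (y /\<^sub>R norm y)) = norm (hprod x (y :: 'k::hermitian_scalar ^ 'n)) / (norm x * norm y)"
proof -
  have s: "norm (hprod u (c *\<^sub>R v)) = \<bar>c\<bar> * norm (hprod u v)" for u v :: "'k ^ 'n" and c
  proof -
    have "hprod u (c *\<^sub>R v) = c *\<^sub>R hprod u v"
      using hprod_add_scaleR [of u 0 c v] by (simp add: hprod_def)
    then show ?thesis by simp
  qed
  then have "norm (hprod (c *\<^sub>R u) v) = \<bar>c\<bar> * norm (hprod u v)" for u v :: "'k ^ 'n" and c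
    by (metis norm_hprod_commute)
  with s show ?thesis by (simp add: field_simps)
qed

text \<open>Schur's test: the matrix of |<y_i,y_j>|^2 is symmetric, nonnegative and has row sums A
  |y_j|^2 by the frame identity at y_j.\<close>

lemma tight_frame_weighted_sum:
  fixes y :: "nat \<Rightarrow> 'k::hermitian_scalar ^ 'n"
  assumes frame: "tight_frame N y A" and A: "A = real N / real CARD('n)" and q: "1 \<le> q" "q \<le> 2"
  shows "(\<Sum>i<N. \<Sum>j<N. norm (y i) powr q * norm (y j) powr q
      * (norm (hprod (y i /\<^sub>R norm (y i)) (y j /\<^sub>R norm (y j))))\<^sup>2) \<le> A * real N"
    (is "?S \<le> _")
proof -
  \<comment> \<open>What remains of |y_i|^q after the normalisation of the inner product has
    contributed the factor |y_i|^(-2); it is 0 for a zero vector.\<close>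
  define c where "c i = norm (y i) powr (q - 2)" for i
  define M where "M i j = (norm (hprod (y i) (y j)))\<^sup>2" for i j
  have sym: "M i j = M j i" for i j
    by (simp add: M_def norm_hprod_commute)
  have row: "(\<Sum>i<N. M j i) = A * (norm (y j))\<^sup>2" for j
    using frame by (simp add: M_def tight_frame_def)
  have "norm (y i) powr q * norm (y j) powr q * (norm (hprod (y i /\<^sub>R norm (y i)) (y j /\<^sub>R norm (y j))))\<^sup>2
    = c i * c j * M i j" for i j
  proof -
    have "t powr (q - 2) = t powr q / t\<^sup>2" if "t \<ge> 0" for t :: real
      using that by (simp add: powr_diff)
    then show ?thesis
      unfolding norm_hprod_normalized c_def M_def by (simp add: power_divide power_mult_distrib)
  qed
  then have "?S = (\<Sum>i<N. \<Sum>j<N. c i * c j * M i j)" by simp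
  also have "\<dots> \<le> (\<Sum>i<N. \<Sum>j<N. (c i)\<^sup>2 / 2 * M i j + (c j)\<^sup>2 / 2 * M j i)"
  proof (intro sum_mono)
    fix i j
    have "c i * c j \<le> (c i)\<^sup>2 / 2 + (c j)\<^sup>2 / 2"
      using sum_squares_bound [of "c i" "c j"] by simp
    then have "c i * c j * M i j \<le> ((c i)\<^sup>2 / 2 + (c j)\<^sup>2 / 2) * M i j"
      by (rule mult_right_mono) (simp add: M_def)
    then show "c i * c j * M i j \<le> (c i)\<^sup>2 / 2 * M i j + (c j)\<^sup>2 / 2 * M j i"
      by (simp add: distrib_right sym [of j])
  qed
  also have "\<dots> = (\<Sum>i<N. \<Sum>j<N. (c i)\<^sup>2 * M i j)"
    unfolding sum.distrib by (subst (2) sum.swap) (simp add: mult.commute flip: sum.distrib)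
  also have "\<dots> = (\<Sum>i<N. A * ((c i)\<^sup>2 * (norm (y i))\<^sup>2))"
    by (simp only: sum_distrib_left [symmetric] row) (simp add: sum_distrib_left mult_ac)
  also have "\<dots> \<le> (\<Sum>i<N. A * (1 + (q - 1) * ((norm (y i))\<^sup>2 - 1)))"
  proof (intro sum_mono mult_left_mono)
    fix i
    have "(c i)\<^sup>2 * (norm (y i))\<^sup>2 \<le> ((norm (y i))\<^sup>2) powr (q - 1)"
    proof (cases "y i = 0")
      case False
      have "(c i)\<^sup>2 * (norm (y i))\<^sup>2 = norm (y i) powr ((q - 2) + (q - 2) + 2)"
        unfolding powr_add c_def using False by (simp add: power2_eq_square)
      also have "\<dots> = norm (y i) powr (2 * (q - 1))"
        by (rule arg_cong) simp
      also have "\<dots> = ((norm (y i))\<^sup>2) powr (q - 1)"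
        using False by (simp add: powr_powr algebra_simps flip: powr_numeral)
      finally show ?thesis by simp
    qed simp
    \<comment> \<open>The exponent q - 1 lies in [0,1]. The linear terms cancel on summation,
      because the sum of |y_i|^2 is N.\<close>
    also have "\<dots> \<le> 1 + (q - 1) * ((norm (y i))\<^sup>2 - 1)"
      using q by (intro powr_le_tangent) auto
    finally show "(c i)\<^sup>2 * (norm (y i))\<^sup>2 \<le> 1 + (q - 1) * ((norm (y i))\<^sup>2 - 1)" .
  qed (simp add: A)
  also have "\<dots> = A * (real N + (q - 1) * ((\<Sum>i<N. (norm (y i))\<^sup>2) - real N))"
    by (simp add: sum_distrib_left sum.distrib sum_subtractf algebra_simps)
  also have "\<dots> = A * real N"
    by (simp add: tight_frame_sum_norm [OF frame] A)
  finally show ?thesis .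
qed

text \<open>Replacing f by h off the diagonal leaves the full double sum for h minus its diagonal.
  The full sum is bounded above, and the diagonal is at least N h(1).\<close>

lemma tight_frame_potential_bound:
  fixes y :: "nat \<Rightarrow> 'k::hermitian_scalar ^ 'n"
  assumes card: "CARD('n) \<ge> 2" and q: "q \<in> {1..2}"
    and a: "a 0 \<ge> 0" "a 1 \<ge> 0" "\<And>k. k \<ge> 2 \<Longrightarrow> a k \<le> 0"
    and f: "\<forall>t\<in>{0..1}. summable (\<lambda>k. a (k + 2) * zonal TYPE('k) CARD('n) (k + 2) t)
          \<and> 0 \<le> f t \<and> f t \<le> majorant TYPE('k) CARD('n) a t"
    and frame: "tight_frame N y (real N / real CARD('n))"
  shows "(\<Sum>i<N. \<Sum>j\<in>{..<N} - {i}. potential q f (y i) (y j))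
    \<le> (real N)\<^sup>2 * (a 1 / real CARD('n) + a 0) - real N * majorant TYPE('k) CARD('n) a 1"
proof -
  let ?h = "majorant TYPE('k) CARD('n) a"
  define u where "u i = y i /\<^sub>R norm (y i)" for i
  define w where "w i = norm (y i) powr q" for i
  define t where "t i j = norm (hprod (u i) (u j))" for i j
  have q12: "1 \<le> q" "q \<le> 2" using q by auto
  have sum_norm: "(\<Sum>i<N. (norm (y i))\<^sup>2) = real N"
    using tight_frame_sum_norm [OF frame] by simp
  have w0: "w i \<ge> 0" for i by (simp add: w_def)
  have unit: "w i = 0 \<or> norm (u i) = 1" for i
    by (cases "y i = 0") (auto simp: w_def u_def)
  have "norm (u i) \<le> 1" for i
    by (cases "y i = 0") (auto simp: u_def)
  then have t01: "t i j \<in> {0..1}" for i j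
    using norm_hprod_le [of "u i" "u j"] mult_le_one [of "norm (u i)" "norm (u j)"]
    by (force simp: t_def)
  \<comment> \<open>A zero vector has weight 0, which reproduces the case distinction in
    \<open>potential\<close>.\<close>
  have pot: "potential q f (y i) (y j) = w i * w j * f (t i j)" for i j
    by (simp add: potential_def w_def t_def u_def)
  \<comment> \<open>If \<open>y i = 0\<close> then \<open>t i i\<close> is 0 instead of 1, but the
    weight vanishes.\<close>
  have diag: "w i * w i * ?h (t i i) = (w i)\<^sup>2 * ?h 1" for i
    using unit [of i] by (auto simp: t_def norm_hprod_self power2_eq_square)
  \<comment> \<open>As powers of |y_i|^2 the weights have exponent q/2, at most 1, so the tangent at
    1 lies above.\<close>
  have sw: "(\<Sum>i<N. w i) \<le> real N"
  proof -
    have "(\<Sum>i<N. w i) \<le> (\<Sum>i<N. 1 + q / 2 * ((norm (y i))\<^sup>2 - 1))"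
    proof (rule sum_mono)
      fix i
      have "w i = ((norm (y i))\<^sup>2) powr (q / 2)"
        by (cases "y i = 0") (simp_all add: w_def powr_powr flip: powr_numeral)
      then show "w i \<le> 1 + q / 2 * ((norm (y i))\<^sup>2 - 1)"
        using powr_le_tangent [of "(norm (y i))\<^sup>2" "q / 2"] q12 by simp
    qed
    also have "\<dots> = real N + q / 2 * ((\<Sum>i<N. (norm (y i))\<^sup>2) - real N)"
      by (simp add: sum_distrib_left sum.distrib sum_subtractf algebra_simps)
    finally show ?thesis by (simp add: sum_norm)
  qed
  \<comment> \<open>The squared weights have exponent q, at least 1, so the tangent lies
    below.\<close>
  have sw2: "real N \<le> (\<Sum>i<N. (w i)\<^sup>2)"
  proof -
    have "real N = real N + q * ((\<Sum>i<N. (norm (y i))\<^sup>2) - real N)"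
      by (simp add: sum_norm)
    also have "\<dots> = (\<Sum>i<N. 1 + q * ((norm (y i))\<^sup>2 - 1))"
      by (simp add: sum_distrib_left sum.distrib sum_subtractf algebra_simps)
    also have "\<dots> \<le> (\<Sum>i<N. (w i)\<^sup>2)"
    proof (rule sum_mono)
      fix i
      have "(w i)\<^sup>2 = ((norm (y i))\<^sup>2) powr q"
        by (cases "y i = 0") (simp_all add: w_def power2_eq_square powr_mult)
      then show "1 + q * ((norm (y i))\<^sup>2 - 1) \<le> (w i)\<^sup>2"
        using powr_ge_tangent [of "(norm (y i))\<^sup>2" q] q12 by simp
    qed
    finally show ?thesis .
  qed
  \<comment> \<open>This sign allows \<open>sw2\<close> to be multiplied by h(1) when the diagonal
    is subtracted.\<close>
  have h1: "?h 1 \<ge> 0"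
    using f [rule_format, of 1] by auto
  have full: "(\<Sum>i<N. \<Sum>j<N. w i * w j * ?h (t i j)) \<le> (real N)\<^sup>2 * (a 1 / real CARD('n) + a 0)"
  proof -
    let ?z = "\<lambda>k i j. a (k + 2) * zonal TYPE('k) CARD('n) (k + 2) (t i j)"
    have summ: "summable (\<lambda>k. ?z k i j)" for i j
      using f t01 by blast
    \<comment> \<open>The finite double sum is taken inside the series; each degree then contributes
      a nonpositive coefficient times a nonnegative quadratic form.\<close>
    have neg: "(\<Sum>i<N. \<Sum>j<N. w i * w j * (\<Sum>k. ?z k i j)) \<le> 0"
    proof -
      have "(\<lambda>k. \<Sum>i<N. \<Sum>j<N. w i * w j * ?z k i j) sums (\<Sum>i<N. \<Sum>j<N. w i * w j * (\<Sum>k. ?z k i j))"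
        by (intro sums_sum sums_mult summable_sums summ)
      moreover have "(\<Sum>i<N. \<Sum>j<N. w i * w j * ?z k i j) \<le> 0" for k
      proof -
        have "(\<Sum>i<N. \<Sum>j<N. w i * w j * ?z k i j)
          = a (k + 2) * (\<Sum>i<N. \<Sum>j<N. w i * w j * zonal TYPE('k) CARD('n) (k + 2) (t i j))"
          by (simp add: sum_distrib_left mult_ac)
        also have "\<dots> \<le> 0"
          unfolding t_def using zonal_nonneg [OF card, of "k + 2" "{..<N}" w u] unit a(3)
          by (intro mult_nonpos_nonneg) auto
        finally show ?thesis .
      qed
      ultimately show ?thesis
        by (rule sums_le [OF _ _ sums_zero, rotated])
    qed
    have "(\<Sum>i<N. \<Sum>j<N. w i * w j * ?h (t i j))
      = a 0 * (\<Sum>i<N. w i)\<^sup>2 + a 1 * (\<Sum>i<N. \<Sum>j<N. w i * w j * (t i j)\<^sup>2)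
        + (\<Sum>i<N. \<Sum>j<N. w i * w j * (\<Sum>k. ?z k i j))"
      by (simp add: majorant_def distrib_left sum.distrib power2_eq_square sum_product sum_distrib_left mult_ac)
    also have "\<dots> \<le> a 0 * (real N)\<^sup>2 + a 1 * (real N / real CARD('n) * real N) + 0"
    proof (intro add_mono mult_left_mono a neg power_mono sw sum_nonneg w0)
      show "(\<Sum>i<N. \<Sum>j<N. w i * w j * (t i j)\<^sup>2) \<le> real N / real CARD('n) * real N"
        unfolding w_def t_def u_def by (rule tight_frame_weighted_sum [OF frame refl q12])
    qed
    finally show ?thesis by (simp add: algebra_simps power2_eq_square)
  qed
  have "(\<Sum>i<N. \<Sum>j\<in>{..<N} - {i}. potential q f (y i) (y j))
    \<le> (\<Sum>i<N. \<Sum>j\<in>{..<N} - {i}. w i * w j * ?h (t i j))"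
    unfolding pot using f t01 w0 by (intro sum_mono mult_left_mono) auto
  also have "\<dots> = (\<Sum>i<N. (\<Sum>j<N. w i * w j * ?h (t i j)) - (w i)\<^sup>2 * ?h 1)"
    by (intro sum.cong refl) (simp add: sum_diff1 diag)
  also have "\<dots> = (\<Sum>i<N. \<Sum>j<N. w i * w j * ?h (t i j)) - (\<Sum>i<N. (w i)\<^sup>2) * ?h 1"
    by (simp add: sum_subtractf sum_distrib_right)
  also have "\<dots> \<le> (real N)\<^sup>2 * (a 1 / real CARD('n) + a 0) - real N * ?h 1"
    using full mult_right_mono [OF sw2 h1] by linarith
  finally show ?thesis .
qed

theorem corollary1:
  fixes q :: real and f :: "real \<Rightarrow> real" and a :: "nat \<Rightarrow> real"
  assumes "CARD('n::finite) \<ge> 2"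
    and "q \<in> {1..2}"
    and "a 0 \<ge> 0" and "a 1 \<ge> 0"
    and "\<And>k. k \<ge> 2 \<Longrightarrow> a k \<le> 0"
  shows
    "((\<forall>t\<in>{0..1}. summable (\<lambda>k. a (k + 2) * zonal TYPE(real) CARD('n) (k + 2) t)
          \<and> 0 \<le> f t \<and> f t \<le> majorant TYPE(real) CARD('n) a t)
        \<longrightarrow> (\<forall>N (y :: nat \<Rightarrow> real ^ 'n). tight_frame N y (real N / real CARD('n)) \<longrightarrow>
          (\<Sum>i<N. \<Sum>j\<in>{..<N} - {i}. potential q f (y i) (y j))
            \<le> (real N)\<^sup>2 * (a 1 / real CARD('n) + a 0) - real N * majorant TYPE(real) CARD('n) a 1)) \<and>
    ((\<forall>t\<in>{0..1}. summable (\<lambda>k. a (k + 2) * zonal TYPE(complex) CARD('n) (k + 2) t)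
          \<and> 0 \<le> f t \<and> f t \<le> majorant TYPE(complex) CARD('n) a t)
        \<longrightarrow> (\<forall>N (y :: nat \<Rightarrow> complex ^ 'n). tight_frame N y (real N / real CARD('n)) \<longrightarrow>
          (\<Sum>i<N. \<Sum>j\<in>{..<N} - {i}. potential q f (y i) (y j))
            \<le> (real N)\<^sup>2 * (a 1 / real CARD('n) + a 0) - real N * majorant TYPE(complex) CARD('n) a 1)) \<and>
    ((\<forall>t\<in>{0..1}. summable (\<lambda>k. a (k + 2) * zonal TYPE(quat) CARD('n) (k + 2) t)
          \<and> 0 \<le> f t \<and> f t \<le> majorant TYPE(quat) CARD('n) a t)
        \<longrightarrow> (\<forall>N (y :: nat \<Rightarrow> quat ^ 'n). tight_frame N y (real N / real CARD('n)) \<longrightarrow>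
          (\<Sum>i<N. \<Sum>j\<in>{..<N} - {i}. potential q f (y i) (y j))
            \<le> (real N)\<^sup>2 * (a 1 / real CARD('n) + a 0) - real N * majorant TYPE(quat) CARD('n) a 1))"
  by (intro conjI allI impI; rule tight_frame_potential_bound [OF assms]; assumption)

end
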